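(* Let $n\in\mathbb{Z}_{>0}$, $k\in\mathbb{Z}_{\ge0}$ and $V=\mathbb{C}^n$. (i) The image of $\tilde\phi_{k+\frac12}:\mathbb{C}I_{k+\frac12}\to\mathrm{End}_{\mathbb{C}}(V^{\otimes(k+\frac12)})$ is $\mathrm{End}_{\mathbb{C}R_{n-1}}(V^{\otimes(k+\frac12)})$. The kernel of $\tilde\phi_{k+\frac12}$ is the $\mathbb{C}$-span of $\{x_d\mid d\in I_{k+\frac12}\text{ and } d\text{ has more than } n\text{ blocks}\}$. In particular, when $n\ge k+1$, $\mathbb{C}I_{k+\frac12}\cong\mathrm{End}_{\mathbb{C}R_{n-1}}(V^{\otimes(k+\frac12)})$. (ii) The image of $\tilde\psi_{k+\frac12}:\mathbb{C}R_{n-1}\to\mathrm{End}_{\mathbb{C}}(V^{\otimes(k+\frac12)})$ is $\mathrm{End}_{\mathbb{C}I_{k+\frac12}}(V^{\otimes(k+\frac12)})$.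
   Context: $R_n$ (the rook monoid) is the monoid, under matrix multiplication, of $n\times n$ matrices with entries in $\{0,1\}$ having at most one nonzero entry in each row and column ($\mathbb{C}R_0=\mathbb{C}$). $R_n$ acts on $V=\mathbb{C}^n$ (standard basis $e_1,\dots,e_n$) by matrix multiplication and on tensor powers diagonally. $R_{n-1}$ is identified with the submonoid of $R_n$ of elements whose $(n,n)$ entry is $1$. $V^{\otimes(k+\frac12)}:=V^{\otimes k}\otimes e_n\subset V^{\otimes(k+1)}$, which is stable under $R_{n-1}$; $\tilde\psi_{k+\frac12}$ is the algebra homomorphism given by this action of $\mathbb{C}R_{n-1}$. A partition diagram on $\{1,\dots,m,1',\dots,m'\}$ is a set partition of this set, drawn as a graph with top row $1,\dots,m$ and bottom row $1',\dots,m'$ whose connected components are the blocks. $A_m$ is the monoid of these diagrams; $d_1\circ d_2$ is obtained by placing $d_1$ above $d_2$, identifying the bottom row of $d_1$ with the top row of $d_2$, and discarding components lying entirely in the middle row. A block is propagating if it meets both rows. $I_m\subset A_m$ is the submonoid of diagrams all of whose blocks are propagating, and $I_{k+\frac12}\subset I_{k+1}$ is the submonoid of diagrams in which $k+1$ and $(k+1)'$ lie in the same block. $\mathbb{C}I_{k+\frac12}$ is its monoid algebra (product $d_1d_2=d_1\circ d_2$). For diagrams, $d'\le d$ means $d'$ is coarser than $d$ (elements in the same block of $d$ are in the same block of $d'$), and the elements $x_d$ are uniquely determined by $d=\sum_{d'\le d}x_{d'}$. $\mathbb{C}I_{k+1}$ acts on $V^{\otimes(k+1)}$ on the right: for $d\in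 I_{k+1}$, $$(e_{i_1}\otimes\cdots\otimes e_{i_{k+1}})\tilde\phi_{k+1}(d)=\sum_{1\le i_{1'},\dots,i_{(k+1)'}\le n}c\;e_{i_{1'}}\otimes\cdots\otimes e_{i_{(k+1)'}},$$ where $c=1$ if $i_r=i_s$ whenever $r,s\in\{1,\dots,k+1,1',\dots,(k+1)'\}$ are in the same block of $d$, and $c=0$ otherwise. The restriction to $\mathbb{C}I_{k+\frac12}$ preserves $V^{\otimes(k+\frac12)}$ and $\tilde\phi_{k+\frac12}$ denotes the resulting (right action) map. *)

theory Defs
  imports
    "HOL-Library.Disjoint_Sets"
    "HOL-Library.Function_Algebras"
    "HOL-Algebra.Module"
    "HOL-Algebra.QuotRing"
    "Jordan_Normal_Form.Matrix"
begin

text \<open>Indices are 0-based throughout: the usual index \<open>r\<close> is \<open>r - 1\<close> here. So the last basis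
  vector \<open>e_n\<close> is \<open>unit_vec n (n - 1)\<close>, and the vertices \<open>k + 1\<close> and \<open>(k + 1)'\<close> are
  \<open>Top k\<close> and \<open>Bot k\<close>.\<close>

section \<open>Rook monoids\<close>

definition rook_monoid :: "nat \<Rightarrow> complex mat monoid" where
  "rook_monoid n =
    \<lparr> carrier = {A \<in> carrier_mat n n.
        (\<forall>i<n. \<forall>j<n. A $$ (i, j) \<in> {0, 1}) \<and>
        (\<forall>i<n. card {j. j < n \<and> A $$ (i, j) \<noteq> 0} \<le> 1) \<and>
        (\<forall>j<n. card {i. i < n \<and> A $$ (i, j) \<noteq> 0} \<le> 1)},
      monoid.mult = (*),
      one = 1\<^sub>m n \<rparr>"

text \<open>\<open>R_{n-1}\<close>, as the submonoid of \<open>R_n\<close> of matrices with last diagonal entry 1 (for \<open>n > 0\<close>).\<close>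

definition rook_submonoid :: "nat \<Rightarrow> complex mat monoid" where
  "rook_submonoid n = (rook_monoid n)
    \<lparr> carrier := {A \<in> carrier (rook_monoid n). A $$ (n - 1, n - 1) = 1} \<rparr>"

section \<open>Partition diagrams\<close>

text \<open>The vertices \<open>Mid r\<close> occur only while two diagrams are being stacked.\<close>

datatype vertex = Top nat | Mid nat | Bot nat

type_synonym diagram = "vertex set set"

definition vertices :: "nat \<Rightarrow> vertex set" where
  "vertices m = Top ` {..<m} \<union> Bot ` {..<m}"

fun to_upper :: "vertex \<Rightarrow> vertex" where
  "to_upper (Bot r) = Mid r"
| "to_upper v = v"

fun to_lower :: "vertex \<Rightarrow> vertex" where
  "to_lower (Top r) = Mid r"
| "to_lower v = v"

text \<open>The blocks of \<open>diagram_comp d1 d2\<close> are the connected components of the stacked graph (\<open>d1\<close> on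
  top), with the middle row removed; components lying entirely in the middle row become empty and
  are discarded.\<close>

definition stack :: "diagram \<Rightarrow> diagram \<Rightarrow> vertex set set" where
  "stack d1 d2 = (`) to_upper ` d1 \<union> (`) to_lower ` d2"

definition diagram_comp :: "diagram \<Rightarrow> diagram \<Rightarrow> diagram" where
  "diagram_comp d1 d2 =
    (\<lambda>C. C - range Mid) ` (\<Union>(stack d1 d2) // (\<Union>B\<in>stack d1 d2. B \<times> B)\<^sup>*) - {{}}"

definition diagram_monoid :: "nat \<Rightarrow> diagram monoid" where
  "diagram_monoid m =
    \<lparr> carrier = {d. partition_on (vertices m) d},
      monoid.mult = diagram_comp,
      one = (\<lambda>r. {Top r, Bot r}) ` {..<m} \<rparr>"

definition propagating :: "vertex set \<Rightarrow> bool" where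
  "propagating B \<longleftrightarrow> B \<inter> range Top \<noteq> {} \<and> B \<inter> range Bot \<noteq> {}"

text \<open>\<open>I_m\<close> and \<open>I_{k+1/2}\<close>.\<close>

definition I_monoid :: "nat \<Rightarrow> diagram monoid" where
  "I_monoid m = (diagram_monoid m)
    \<lparr> carrier := {d \<in> carrier (diagram_monoid m). \<forall>B\<in>d. propagating B} \<rparr>"

definition I_half_monoid :: "nat \<Rightarrow> diagram monoid" where
  "I_half_monoid k = (I_monoid (Suc k))
    \<lparr> carrier := {d \<in> carrier (I_monoid (Suc k)). \<exists>B\<in>d. Top k \<in> B \<and> Bot k \<in> B} \<rparr>"

section \<open>Complex vector spaces of functions and monoid algebras\<close>

definition cscale :: "complex \<Rightarrow> ('a \<Rightarrow> complex) \<Rightarrow> 'a \<Rightarrow> complex" where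
  "cscale c f = (\<lambda>x. c * f x)"

global_interpretation cfun: vector_space cscale
  defines cspan = cfun.span
  by unfold_locales (auto simp: cscale_def fun_eq_iff algebra_simps)

text \<open>Elements of the monoid algebra are finitely supported coefficient functions.\<close>

definition monoid_algebra :: "('m, 'b) monoid_scheme \<Rightarrow> (complex, 'm \<Rightarrow> complex) module" where
  "monoid_algebra M =
    \<lparr> carrier = {f. finite {x. f x \<noteq> 0} \<and> {x. f x \<noteq> 0} \<subseteq> carrier M},
      monoid.mult = (\<lambda>f g z. \<Sum>(x, y) \<in> {(x, y). f x \<noteq> 0 \<and> g y \<noteq> 0 \<and> x \<otimes>\<^bsub>M\<^esub> y = z}. f x * g y),
      one = (\<lambda>z. of_bool (z = \<one>\<^bsub>M\<^esub>)),
      zero = 0,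
      add = (+),
      smult = cscale \<rparr>"

definition linear_extension ::
  "('m, 'b) monoid_scheme \<Rightarrow> ('m \<Rightarrow> ('i \<Rightarrow> complex) \<Rightarrow> 'i \<Rightarrow> complex)
    \<Rightarrow> ('m \<Rightarrow> complex) \<Rightarrow> ('i \<Rightarrow> complex) \<Rightarrow> 'i \<Rightarrow> complex" where
  "linear_extension M act a t = (\<Sum>g\<in>carrier M. cscale (a g) (act g t))"

text \<open>The elements \<open>x_d\<close>, for diagrams \<open>d\<close> in \<open>A_m\<close>. Here \<open>d' \<le> d\<close> (\<open>d'\<close> coarser than \<open>d\<close>) is
  \<open>refines (vertices m) d d'\<close>, and the diagram \<open>d\<close> is the indicator function of \<open>{d}\<close>. The lemma
  \<open>x_basis_ex1\<close> below shows that the description is definite.\<close>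

definition is_x_basis :: "nat \<Rightarrow> (diagram \<Rightarrow> diagram \<Rightarrow> complex) \<Rightarrow> bool" where
  "is_x_basis m x \<longleftrightarrow>
    x \<in> extensional (carrier (diagram_monoid m)) \<and>
    (\<forall>d\<in>carrier (diagram_monoid m).
      (\<lambda>e. of_bool (e = d)) =
        (\<Sum>d' \<in> {d' \<in> carrier (diagram_monoid m). refines (vertices m) d d'}. x d'))"

definition x_basis :: "nat \<Rightarrow> diagram \<Rightarrow> diagram \<Rightarrow> complex" where
  "x_basis m = (THE x. is_x_basis m x)"

section \<open>Tensor powers\<close>

text \<open>A tensor in the \<open>m\<close>-th tensor power of \<open>\<complex>\<^sup>n\<close> is given by its coordinates with respect to the
  basis \<open>e_{i_1} \<otimes> \<dots> \<otimes> e_{i_m}\<close>, which is indexed by \<open>tuples n m\<close>.\<close>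

definition tuples :: "nat \<Rightarrow> nat \<Rightarrow> (nat \<Rightarrow> nat) set" where
  "tuples n m = {..<m} \<rightarrow>\<^sub>E {..<n}"

type_synonym tensor = "(nat \<Rightarrow> nat) \<Rightarrow> complex"

definition tensor_power :: "nat \<Rightarrow> nat \<Rightarrow> tensor set" where
  "tensor_power n m = {t. \<forall>i. i \<notin> tuples n m \<longrightarrow> t i = 0}"

definition tensor_vec :: "nat \<Rightarrow> nat \<Rightarrow> tensor \<Rightarrow> complex vec \<Rightarrow> tensor" where
  "tensor_vec n m t v =
    (\<lambda>i. if i \<in> tuples n (Suc m) then t (restrict i {..<m}) * v $ i m else 0)"

definition half_power :: "nat \<Rightarrow> nat \<Rightarrow> tensor set" where
  "half_power n k = (\<lambda>t. tensor_vec n k t (unit_vec n (n - 1))) ` tensor_power n k"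

text \<open>The diagonal action \<open>A e_{i_1} \<otimes> \<dots> \<otimes> A e_{i_m}\<close>, extended linearly; see also
  \<open>mat_action_pure\<close> below.\<close>

definition mat_action :: "nat \<Rightarrow> nat \<Rightarrow> complex mat \<Rightarrow> tensor \<Rightarrow> tensor" where
  "mat_action n m A t =
    (\<lambda>j. if j \<in> tuples n m
      then \<Sum>i\<in>tuples n m. (\<Prod>r<m. A $$ (j r, i r)) * t i else 0)"

fun vertex_label :: "(nat \<Rightarrow> nat) \<Rightarrow> (nat \<Rightarrow> nat) \<Rightarrow> vertex \<Rightarrow> nat" where
  "vertex_label i j (Top r) = i r"
| "vertex_label i j (Bot r) = j r"
| "vertex_label i j (Mid r) = undefined"

definition diagram_coeff :: "diagram \<Rightarrow> (nat \<Rightarrow> nat) \<Rightarrow> (nat \<Rightarrow> nat) \<Rightarrow> complex" where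
  "diagram_coeff d i j =
    (if \<forall>B\<in>d. \<forall>u\<in>B. \<forall>v\<in>B. vertex_label i j u = vertex_label i j v then 1 else 0)"

definition diagram_action :: "nat \<Rightarrow> nat \<Rightarrow> diagram \<Rightarrow> tensor \<Rightarrow> tensor" where
  "diagram_action n m d t =
    (\<lambda>j. if j \<in> tuples n m then \<Sum>i\<in>tuples n m. t i * diagram_coeff d i j else 0)"

definition tpsi_half :: "nat \<Rightarrow> nat \<Rightarrow> (complex mat \<Rightarrow> complex) \<Rightarrow> tensor \<Rightarrow> tensor" where
  "tpsi_half n k a =
    restrict (linear_extension (rook_submonoid n) (mat_action n (Suc k)) a) (half_power n k)"

definition tphi_half :: "nat \<Rightarrow> nat \<Rightarrow> (diagram \<Rightarrow> complex) \<Rightarrow> tensor \<Rightarrow> tensor" where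
  "tphi_half n k a =
    restrict (linear_extension (I_half_monoid k) (diagram_action n (Suc k)) a) (half_power n k)"

section \<open>Endomorphism algebras\<close>

text \<open>The product of \<open>f\<close> and \<open>g\<close> is ``first \<open>f\<close>, then \<open>g\<close>'': the endomorphisms are written on the
  right, as is appropriate for the right action of the diagram algebra.\<close>

definition End_C :: "('i \<Rightarrow> complex) set \<Rightarrow> (complex, ('i \<Rightarrow> complex) \<Rightarrow> 'i \<Rightarrow> complex) module" where
  "End_C W =
    \<lparr> carrier = {f \<in> W \<rightarrow>\<^sub>E W. (\<forall>u\<in>W. \<forall>v\<in>W. f (u + v) = f u + f v) \<and>
                              (\<forall>c. \<forall>u\<in>W. f (cscale c u) = cscale c (f u))},
      monoid.mult = (\<lambda>f g. compose W g f),
      one = (\<lambda>w\<in>W. w),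
      zero = (\<lambda>w\<in>W. 0),
      add = (\<lambda>f g. \<lambda>w\<in>W. f w + g w),
      smult = (\<lambda>c f. \<lambda>w\<in>W. cscale c (f w)) \<rparr>"

text \<open>The subalgebra of endomorphisms commuting with the operators \<open>\<rho> a\<close>, where \<open>a\<close> ranges over an
  algebra \<open>A\<close> acting on \<open>W\<close> (on the left or on the right) through \<open>\<rho>\<close>.\<close>

definition End_over ::
  "(complex, 'a, 'b) module_scheme \<Rightarrow> ('a \<Rightarrow> ('i \<Rightarrow> complex) \<Rightarrow> 'i \<Rightarrow> complex) \<Rightarrow> ('i \<Rightarrow> complex) set
    \<Rightarrow> (complex, ('i \<Rightarrow> complex) \<Rightarrow> 'i \<Rightarrow> complex) module" where
  "End_over A \<rho> W = (End_C W)
    \<lparr> carrier := {f \<in> carrier (End_C W). \<forall>a\<in>carrier A. \<forall>w\<in>W. f (\<rho> a w) = \<rho> a (f w)} \<rparr>"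

definition algebra_isomorphic ::
  "(complex, 'a, 'b) module_scheme \<Rightarrow> (complex, 'c, 'd) module_scheme \<Rightarrow> bool" where
  "algebra_isomorphic A B \<longleftrightarrow>
    (\<exists>h\<in>ring_iso A B. \<forall>c. \<forall>x\<in>carrier A. h (c \<odot>\<^bsub>A\<^esub> x) = c \<odot>\<^bsub>B\<^esub> h x)"

section \<open>Consistency of the definitions\<close>

lemma finite_vertices: "finite (vertices m)"
  by (simp add: vertices_def)

lemma finite_diagrams: "finite (carrier (diagram_monoid m))"
  by (simp add: diagram_monoid_def finitely_many_partition_on finite_vertices)

lemma card_less_of_refines:
  assumes "finite A" "refines A P Q" "P \<noteq> Q"
  shows "card Q < card P"
proof -
  have P: "partition_on A P" and Q: "partition_on A Q"
    and sub: "\<forall>X\<in>P. \<exists>Y\<in>Q. X \<subseteq> Y"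
    using assms(2) by (auto simp: refines_def)
  have finP: "finite P" using P assms(1) finite_elements by blast
  obtain f where f: "\<And>X. X \<in> P \<Longrightarrow> f X \<in> Q \<and> X \<subseteq> f X"
    using sub by metis
  have fY: "f X = Y" if "X \<in> P" "Y \<in> Q" "x \<in> X" "x \<in> Y" for X Y x
    using partition_onD2[OF Q] f[OF that(1)] that by (auto simp: disjoint_def)
  have surj: "f ` P = Q"
  proof
    show "f ` P \<subseteq> Q" using f by auto
    show "Q \<subseteq> f ` P"
    proof
      fix Y assume Y: "Y \<in> Q"
      then obtain x where x: "x \<in> Y" using partition_onD3[OF Q] by (cases "Y = {}") auto
      then have "x \<in> A" using Y partition_onD1[OF Q] by auto
      then obtain X where "X \<in> P" "x \<in> X" using partition_onD1[OF P] by auto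
      then show "Y \<in> f ` P" using fY[OF _ Y _ x] by auto
    qed
  qed
  have "\<not> inj_on f P"
  proof
    assume inj: "inj_on f P"
    have "f X = X" if X: "X \<in> P" for X
    proof
      show "X \<subseteq> f X" using f X by auto
      show "f X \<subseteq> X"
      proof
        fix x assume x: "x \<in> f X"
        then have "x \<in> A" using f X partition_onD1[OF Q] by auto
        then obtain X' where X': "X' \<in> P" "x \<in> X'" using partition_onD1[OF P] by auto
        then have "f X' = f X" using fY x f X by blast
        then show "x \<in> X" using inj X X' by (auto dest: inj_onD)
      qed
    qed
    then have "f ` P = P" by simp
    then show False using surj assms(3) by simp
  qed
  then have "card (f ` P) < card P"
    using finP card_image_le[of P f] eq_card_imp_inj_on[of P f] by fastforce
  then show ?thesis using surj by simp
qed

lemma x_basis_ex1: "\<exists>!x. is_x_basis m x"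
proof -
  let ?D = "carrier (diagram_monoid m)"
  let ?V = "vertices m"
  define U where "U d = {d' \<in> ?D. refines ?V d d'} - {d}" for d
  define ind :: "diagram \<Rightarrow> diagram \<Rightarrow> complex" where "ind d = (\<lambda>e. of_bool (e = d))" for d
  have split: "{d' \<in> ?D. refines ?V d d'} = insert d (U d)" if "d \<in> ?D" for d
    using that refines_refl by (auto simp: U_def diagram_monoid_def)
  have finU: "finite (U d)" and dU: "d \<notin> U d" for d
    using finite_diagrams by (auto simp: U_def)
  have less: "card d' < card d" "d' \<in> ?D" if "d' \<in> U d" for d d'
    using that card_less_of_refines[OF finite_vertices, of m d d'] by (auto simp: U_def)
  have eq: "is_x_basis m x \<longleftrightarrow> x \<in> extensional ?D \<and> (\<forall>d\<in>?D. x d = ind d - (\<Sum>d'\<in>U d. x d'))" for x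
  proof -
    have "(\<lambda>e. of_bool (e = d)) = (\<Sum>d' \<in> {d' \<in> ?D. refines ?V d d'}. x d')
        \<longleftrightarrow> x d = ind d - (\<Sum>d'\<in>U d. x d')" if "d \<in> ?D" for d
      unfolding split[OF that] sum.insert[OF finU dU] ind_def[symmetric]
      by (auto simp: algebra_simps)
    then show ?thesis unfolding is_x_basis_def by blast
  qed
  have "\<exists>x. \<forall>d\<in>?D. card d < N \<longrightarrow> x d = ind d - (\<Sum>d'\<in>U d. x d')" for N :: nat
  proof (induction N)
    case (Suc N)
    then obtain x where x: "\<And>d. d \<in> ?D \<Longrightarrow> card d < N \<Longrightarrow> x d = ind d - (\<Sum>d'\<in>U d. x d')"
      by blast
    define y where "y d = (if card d < N then x d else ind d - (\<Sum>d'\<in>U d. x d'))" for d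
    have "y d = ind d - (\<Sum>d'\<in>U d. y d')" if d: "d \<in> ?D" "card d < Suc N" for d
    proof -
      have "(\<Sum>d'\<in>U d. y d') = (\<Sum>d'\<in>U d. x d')"
        using less d by (intro sum.cong) (fastforce simp: y_def)+
      then show ?thesis using x[OF d(1)] by (simp add: y_def)
    qed
    then show ?case by blast
  qed simp
  moreover obtain N where N: "\<And>d. d \<in> ?D \<Longrightarrow> card d < N"
  proof
    show "card d < Suc (Max (card ` ?D))" if "d \<in> ?D" for d
      using that finite_diagrams by (simp add: less_Suc_eq_le)
  qed
  ultimately obtain x where x: "\<And>d. d \<in> ?D \<Longrightarrow> x d = ind d - (\<Sum>d'\<in>U d. x d')"
    by meson
  have ex: "is_x_basis m (restrict x ?D)"
  proof -
    have "(\<Sum>d'\<in>U d. restrict x ?D d') = (\<Sum>d'\<in>U d. x d')" for d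
      by (intro sum.cong) (auto simp: U_def)
    then show ?thesis unfolding eq using x by simp
  qed
  have uniq: "y = z" if y: "is_x_basis m y" and z: "is_x_basis m z" for y z
  proof -
    have "y d = z d" if "d \<in> ?D" for d
      using that
    proof (induction "card d" arbitrary: d rule: less_induct)
      case less': less
      have "(\<Sum>d'\<in>U d. y d') = (\<Sum>d'\<in>U d. z d')"
        using less less'.hyps by (intro sum.cong) auto
      then show ?case using y z less'.prems unfolding eq by metis
    qed
    then show ?thesis using y z unfolding eq by (blast intro: extensionalityI)
  qed
  show ?thesis using ex uniq by blast
qed

lemma mat_action_pure:
  assumes A: "A \<in> carrier_mat n n" and v: "\<And>r. r < m \<Longrightarrow> v r \<in> carrier_vec n"
  shows "mat_action n m A (\<lambda>i. if i \<in> tuples n m then \<Prod>r<m. v r $ i r else 0)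
    = (\<lambda>i. if i \<in> tuples n m then \<Prod>r<m. (A *\<^sub>v v r) $ i r else 0)"
proof
  fix j
  show "mat_action n m A (\<lambda>i. if i \<in> tuples n m then \<Prod>r<m. v r $ i r else 0) j
    = (if j \<in> tuples n m then \<Prod>r<m. (A *\<^sub>v v r) $ j r else 0)"
  proof (cases "j \<in> tuples n m")
    case True
    have "(A *\<^sub>v v r) $ j r = (\<Sum>s<n. A $$ (j r, s) * v r $ s)" if "r < m" for r
      using A v[OF that] True that
      by (auto simp: tuples_def PiE_iff scalar_prod_def lessThan_atLeast0 intro!: sum.cong)
    then have "(\<Prod>r<m. (A *\<^sub>v v r) $ j r) = (\<Prod>r<m. \<Sum>s<n. A $$ (j r, s) * v r $ s)"
      by simp
    also have "\<dots> = (\<Sum>i\<in>tuples n m. \<Prod>r<m. A $$ (j r, i r) * v r $ i r)"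
      unfolding tuples_def by (rule prod_sum_PiE) auto
    finally show ?thesis using True by (simp add: mat_action_def prod.distrib)
  qed (simp add: mat_action_def)
qed

end

theory Submission
  imports Defs
begin

text \<open>Both parts say that two explicit spaces of matrices are the commutants of each other. A basis
  of \<open>W\<close> is given by the tensors \<open>e_i\<close> with \<open>i\<close> in the set \<open>T = last_tuples n k\<close> of
  \<open>(k + 1)\<close>-tuples ending in \<open>n - 1\<close>, so operators on \<open>W\<close> are \<open>T \<times> T\<close> matrices.

  A diagram \<open>d\<close> acts by the matrix whose \<open>(i, j)\<close> entry is 1 if \<open>d\<close> is finer than the partition of
  the vertices by their labels \<open>i\<close>, \<open>j\<close> (\<open>kernel_diagram\<close>), and 0 otherwise. A rook matrix \<open>A\<close> acts by
  the matrix whose \<open>(i, j)\<close> entry is 1 if the set \<open>pairs\<close> of all \<open>(i r, j r)\<close> is contained in the set of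
  nonzero positions of \<open>A\<close>. Hence every entry of the matrix of an algebra element is a sum of its
  coefficients over an upper set of a finite order. Such sums can be prescribed arbitrarily
  (\<open>zeta_surjective\<close>), and this determines both images. The image of the diagram algebra consists of
  the matrices of \<open>partition_type\<close>: the \<open>(i, j)\<close> entry depends only on the kernel diagram, and is 0
  unless \<open>i\<close> and \<open>j\<close> have the same set of values. The image of the rook monoid algebra consists of the
  matrices of \<open>bijection_type\<close>: the \<open>(i, j)\<close> entry depends only on the set of pairs, and is 0 unless
  this set is a partial bijection.

  The two types commute because a path \<open>i, l, j\<close> consisting of a step with equal sets of values and a
  step along a partial bijection can be completed to a commutative square, in which the same two kinds
  of steps occur in the opposite order (\<open>types_commute\<close>). Conversely, a matrix that commutes with the
  indicator matrix of each single partial bijection is of partition type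
  (\<open>centralizer_bijection_type\<close>), and a matrix that commutes with the indicator matrix of each single
  diagram is of bijection type (\<open>centralizer_partition_type\<close>).

  For the kernel, write \<open>s\<^sub>a e\<close> for the sum of the coefficients of \<open>a\<close> over all diagrams finer than
  \<open>e\<close>. Then \<open>a\<close> is the sum of all \<open>s\<^sub>a e x\<^sub>e\<close>, the function \<open>s\<close> of \<open>x\<^sub>c\<close> is the indicator of \<open>c\<close>, and the
  entries of the matrix of \<open>a\<close> are the numbers \<open>s\<^sub>a e\<close> for the diagrams \<open>e\<close> that are kernel diagrams.
  Within \<open>I_{k+1/2}\<close> these are the diagrams with at most \<open>n\<close> blocks, as one needs a different label for
  each block. If \<open>n \<ge> k + 1\<close>, all diagrams in \<open>I_{k+1/2}\<close> are of this kind, so the kernel is zero.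
  Finally, the action is multiplicative because in the composition of two such diagrams each vertex of
  the middle row is joined to the top row, so that the labels of the outer rows determine those of the
  middle row (\<open>sum_diagram_coeff\<close>).\<close>

section \<open>Sums over the upper sets of a finite order\<close>

lemma sum_fun_apply: "(\<Sum>x\<in>A. f x) y = (\<Sum>x\<in>A. f x y)"
  by (induction A rule: infinite_finite_induct) (auto simp: zero_fun_def plus_fun_def)

text \<open>The matrix of the relation is unitriangular when the elements are sorted by rank, and therefore
  invertible. The induction removes an element of maximal rank, whose own upper set is a singleton.\<close>

lemma zeta_surjective:
  fixes r :: "'a \<Rightarrow> nat" and b :: "'a \<Rightarrow> complex"
  assumes "finite P"
    and refl: "\<And>p. p \<in> P \<Longrightarrow> below p p"
    and rank: "\<And>p q. p \<in> P \<Longrightarrow> q \<in> P \<Longrightarrow> below p q \<Longrightarrow> p \<noteq> q \<Longrightarrow> r p < r q"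
  shows "\<exists>a. \<forall>p\<in>P. (\<Sum>q\<in>{q\<in>P. below p q}. a q) = b p"
  using assms
proof (induction P arbitrary: b rule: finite_ranking_induct[where f = r])
  case empty
  then show ?case by simp
next
  case (insert x S)
  show ?case
  proof (cases "x \<in> S")
    case True
    then show ?thesis using insert by (simp add: insert_absorb)
  next
    case False
    have "\<exists>a. \<forall>p\<in>S. (\<Sum>q\<in>{q\<in>S. below p q}. a q) = b p - (if below p x then b x else 0)"
      by (rule insert.IH) (use insert.prems in auto)
    then obtain a where a: "\<And>p. p \<in> S \<Longrightarrow>
        (\<Sum>q\<in>{q\<in>S. below p q}. a q) = b p - (if below p x then b x else 0)"
      by blast
    have "(\<Sum>q\<in>{q \<in> insert x S. below p q}. (a(x := b x)) q) = b p" if p: "p \<in> insert x S" for p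
    proof (cases "p = x")
      case True
      have "{q \<in> insert x S. below x q} = {x}"
        using insert.prems insert.hyps False by fastforce
      then show ?thesis using True by simp
    next
      case pS: False
      then have "p \<in> S" using p by simp
      have eq: "(\<Sum>q\<in>{q\<in>S. below p q}. (a(x := b x)) q) = (\<Sum>q\<in>{q\<in>S. below p q}. a q)"
        using False by (intro sum.cong) auto
      have "{q \<in> insert x S. below p q} = (if below p x then insert x {q\<in>S. below p q} else {q\<in>S. below p q})"
        by auto
      then show ?thesis using eq a[OF \<open>p \<in> S\<close>] False insert.hyps(1) by simp
    qed
    then show ?thesis by blast
  qed
qed

section \<open>Operators as matrices\<close>

definition supported :: "'i set \<Rightarrow> ('i \<Rightarrow> complex) set" where
  "supported T = {w. \<forall>i. i \<notin> T \<longrightarrow> w i = 0}"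

text \<open>Row \<open>i\<close> of the matrix holds the coordinates of the image of the \<open>i\<close>-th basis tensor. With this
  convention the matrix product lists the factors in the order of application, in agreement with
  the product of \<open>End_C\<close>.\<close>

definition matrix_op :: "'i set \<Rightarrow> ('i \<Rightarrow> 'i \<Rightarrow> complex) \<Rightarrow> ('i \<Rightarrow> complex) \<Rightarrow> 'i \<Rightarrow> complex" where
  "matrix_op T F = (\<lambda>w\<in>supported T. \<lambda>j. if j \<in> T then \<Sum>i\<in>T. w i * F i j else 0)"

definition matrix_mult ::
  "'i set \<Rightarrow> ('i \<Rightarrow> 'i \<Rightarrow> complex) \<Rightarrow> ('i \<Rightarrow> 'i \<Rightarrow> complex) \<Rightarrow> 'i \<Rightarrow> 'i \<Rightarrow> complex" where
  "matrix_mult T F G i j = (\<Sum>l\<in>T. F i l * G l j)"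

definition basis_tensor :: "'i \<Rightarrow> 'i \<Rightarrow> complex" where
  "basis_tensor i = (\<lambda>j. of_bool (j = i))"

lemma matrix_op_closed: "w \<in> supported T \<Longrightarrow> matrix_op T F w \<in> supported T"
  by (simp add: matrix_op_def supported_def)

lemma basis_tensor_supported: "i \<in> T \<Longrightarrow> basis_tensor i \<in> supported T"
  by (auto simp: basis_tensor_def supported_def)

lemma matrix_op_basis_tensor:
  assumes "finite T" "i \<in> T" "j \<in> T"
  shows "matrix_op T F (basis_tensor i) j = F i j"
  using assms
  by (simp add: matrix_op_def basis_tensor_supported) (simp add: basis_tensor_def if_distrib sum.delta)

lemma matrix_op_cong:
  assumes "\<And>i j. i \<in> T \<Longrightarrow> j \<in> T \<Longrightarrow> F i j = G i j"
  shows "matrix_op T F = matrix_op T G"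
  unfolding matrix_op_def using assms by (intro restrict_ext ext) auto

lemma matrix_op_eqD:
  assumes "finite T" "matrix_op T F = matrix_op T G" "i \<in> T" "j \<in> T"
  shows "F i j = G i j"
  using matrix_op_basis_tensor[OF assms(1,3,4)] assms(2) by metis

lemma matrix_op_comp:
  assumes "finite T" "w \<in> supported T"
  shows "matrix_op T G (matrix_op T F w) = matrix_op T (matrix_mult T F G) w"
proof
  fix j
  have "(\<Sum>l\<in>T. (\<Sum>i\<in>T. w i * F i l) * G l j) = (\<Sum>i\<in>T. w i * (\<Sum>l\<in>T. F i l * G l j))"
    by (simp add: sum_distrib_left sum_distrib_right mult.assoc) (rule sum.swap)
  then show "matrix_op T G (matrix_op T F w) j = matrix_op T (matrix_mult T F G) w j"
    using assms(2) matrix_op_closed[OF assms(2), of F]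
    by (simp add: matrix_op_def matrix_mult_def)
qed

lemma matrix_op_End: "matrix_op T F \<in> carrier (End_C (supported T))"
  by (auto simp: End_C_def matrix_op_def supported_def cscale_def fun_eq_iff algebra_simps
      sum.distrib sum_distrib_left)

lemma End_C_matrix_op:
  assumes fin: "finite T" and f: "f \<in> carrier (End_C (supported T))"
  shows "f = matrix_op T (\<lambda>i. f (basis_tensor i))"
proof
  let ?W = "supported T"
  fix w
  have fW: "f \<in> ?W \<rightarrow>\<^sub>E ?W"
    and add: "\<And>u v. u \<in> ?W \<Longrightarrow> v \<in> ?W \<Longrightarrow> f (u + v) = f u + f v"
    and scale: "\<And>c u. u \<in> ?W \<Longrightarrow> f (cscale c u) = cscale c (f u)"
    using f by (auto simp: End_C_def)
  show "f w = matrix_op T (\<lambda>i. f (basis_tensor i)) w"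
  proof (cases "w \<in> ?W")
    case w: True
    have "(\<Sum>i\<in>S. cscale (w i) (basis_tensor i)) \<in> ?W
        \<and> f (\<Sum>i\<in>S. cscale (w i) (basis_tensor i)) = (\<Sum>i\<in>S. cscale (w i) (f (basis_tensor i)))"
      if "S \<subseteq> T" for S
      using finite_subset[OF that fin] that
    proof (induction S)
      case empty
      have z: "(0 :: 'a \<Rightarrow> complex) \<in> ?W" by (simp add: supported_def)
      have "f 0 = 0" using add[OF z z] by simp
      then show ?case using z by (simp add: zero_fun_def)
    next
      case (insert x S)
      have bx: "basis_tensor x \<in> ?W" "cscale (w x) (basis_tensor x) \<in> ?W"
        using insert.prems by (auto simp: basis_tensor_def supported_def cscale_def)
      have sum: "u + v \<in> ?W" if "u \<in> ?W" "v \<in> ?W" for u v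
        using that by (auto simp: supported_def)
      have IH: "(\<Sum>i\<in>S. cscale (w i) (basis_tensor i)) \<in> ?W"
        "f (\<Sum>i\<in>S. cscale (w i) (basis_tensor i)) = (\<Sum>i\<in>S. cscale (w i) (f (basis_tensor i)))"
        using insert.IH insert.prems by blast+
      show ?case
        unfolding sum.insert[OF insert.hyps]
        using sum[OF bx(2) IH(1)] add[OF bx(2) IH(1)] scale[OF bx(1)] IH(2) by metis
    qed
    note sum_f = this[OF order_refl]
    have "w = (\<Sum>i\<in>T. cscale (w i) (basis_tensor i))"
      using w fin
      by (auto simp: fun_eq_iff sum_fun_apply cscale_def basis_tensor_def supported_def
          if_distrib sum.delta Int_insert_right)
    then have "f w = (\<Sum>i\<in>T. cscale (w i) (f (basis_tensor i)))" using sum_f by metis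
    moreover have "f w j = 0" if "j \<notin> T" for j
      using fW w that by (auto simp: supported_def PiE_iff)
    ultimately show ?thesis
      using w by (auto simp: matrix_op_def fun_eq_iff sum_fun_apply cscale_def)
  next
    case False
    then show ?thesis using fW by (simp add: matrix_op_def PiE_def extensional_def)
  qed
qed

lemma matrix_op_commute_iff:
  assumes "finite T"
  shows "(\<forall>w\<in>supported T. matrix_op T F (matrix_op T G w) = matrix_op T G (matrix_op T F w)) \<longleftrightarrow>
    (\<forall>i\<in>T. \<forall>j\<in>T. matrix_mult T F G i j = matrix_mult T G F i j)"
proof
  assume L: "\<forall>w\<in>supported T. matrix_op T F (matrix_op T G w) = matrix_op T G (matrix_op T F w)"
  have "matrix_op T (matrix_mult T G F) = matrix_op T (matrix_mult T F G)"
  proof (rule extensionalityI)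
    fix w assume w: "w \<in> supported T"
    show "matrix_op T (matrix_mult T G F) w = matrix_op T (matrix_mult T F G) w"
      unfolding matrix_op_comp[OF assms w, symmetric] using L w by simp
  qed (simp_all add: matrix_op_def)
  then show "\<forall>i\<in>T. \<forall>j\<in>T. matrix_mult T F G i j = matrix_mult T G F i j"
    using matrix_op_eqD[OF assms] by metis
next
  assume "\<forall>i\<in>T. \<forall>j\<in>T. matrix_mult T F G i j = matrix_mult T G F i j"
  then have "matrix_op T (matrix_mult T G F) = matrix_op T (matrix_mult T F G)"
    by (intro matrix_op_cong) auto
  then show "\<forall>w\<in>supported T. matrix_op T F (matrix_op T G w) = matrix_op T G (matrix_op T F w)"
    using assms by (simp add: matrix_op_comp)
qed

lemma matrix_op_add:
  "matrix_op T (\<lambda>i j. F i j + G i j) = (\<lambda>w\<in>supported T. matrix_op T F w + matrix_op T G w)"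
  unfolding matrix_op_def by (intro restrict_ext) (auto simp: fun_eq_iff algebra_simps sum.distrib)

lemma matrix_op_scale:
  "matrix_op T (\<lambda>i j. c * F i j) = (\<lambda>w\<in>supported T. cscale c (matrix_op T F w))"
  unfolding matrix_op_def
  by (intro restrict_ext) (auto simp: fun_eq_iff cscale_def sum_distrib_left algebra_simps)

lemma matrix_op_one:
  assumes "finite T"
  shows "matrix_op T (\<lambda>i j. of_bool (j = i)) = (\<lambda>w\<in>supported T. w)"
proof -
  have "(\<Sum>i\<in>T. w i * of_bool (j = i)) = w j" if "j \<in> T" for w :: "'a \<Rightarrow> complex" and j
  proof -
    have "(\<Sum>i\<in>T. w i * of_bool (j = i)) = (\<Sum>i\<in>T. if j = i then w i else 0)"
      by (intro sum.cong) auto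
    then show ?thesis using assms that by simp
  qed
  then show ?thesis
    unfolding matrix_op_def by (intro restrict_ext) (auto simp: fun_eq_iff supported_def)
qed

lemma matrix_op_compose:
  assumes "finite T"
  shows "compose (supported T) (matrix_op T G) (matrix_op T F) = matrix_op T (matrix_mult T F G)"
proof (rule extensionalityI)
  fix w assume "w \<in> supported T"
  then show "compose (supported T) (matrix_op T G) (matrix_op T F) w = matrix_op T (matrix_mult T F G) w"
    using matrix_op_comp[OF assms] by (simp add: compose_def)
qed (simp_all add: matrix_op_def compose_def)

lemma matrix_op_zero_iff:
  assumes "finite T"
  shows "matrix_op T F = (\<lambda>w\<in>supported T. 0) \<longleftrightarrow> (\<forall>i\<in>T. \<forall>j\<in>T. F i j = 0)"
proof -
  have "(\<lambda>w\<in>supported T. 0) = matrix_op T (\<lambda>i j. 0)"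
    unfolding matrix_op_def by (intro restrict_ext) (auto simp: fun_eq_iff)
  then show ?thesis using matrix_op_eqD[OF assms, of F "\<lambda>i j. 0"] matrix_op_cong[of T F "\<lambda>i j. 0"] by metis
qed

lemma End_over_matrix_op_iff:
  assumes "finite T"
  shows "matrix_op T F \<in> carrier (End_over A (\<lambda>a. matrix_op T (M a)) (supported T)) \<longleftrightarrow>
    (\<forall>a\<in>carrier A. \<forall>i\<in>T. \<forall>j\<in>T. matrix_mult T F (M a) i j = matrix_mult T (M a) F i j)"
  using matrix_op_commute_iff[OF assms] by (simp add: End_over_def matrix_op_End)

lemma End_over_matrix_op:
  assumes "finite T" "f \<in> carrier (End_over A \<rho> (supported T))"
  obtains F where "f = matrix_op T F"
  using assms End_C_matrix_op[OF assms(1)] by (auto simp: End_over_def)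

text \<open>The maps \<open>tphi_half\<close> and \<open>tpsi_half\<close> are both linear extensions of monoid actions; this turns them
  into matrices once the matrices of the monoid elements are known.\<close>

lemma restrict_linear_extension:
  assumes "\<And>g w j. g \<in> carrier M \<Longrightarrow> w \<in> supported T \<Longrightarrow>
    act g w j = (if j \<in> T then \<Sum>i\<in>T. w i * c g i j else 0)"
  shows "restrict (linear_extension M act a) (supported T) =
    matrix_op T (\<lambda>i j. \<Sum>g\<in>carrier M. a g * c g i j)"
proof (rule extensionalityI)
  fix w assume w: "w \<in> supported T"
  show "restrict (linear_extension M act a) (supported T) w =
      matrix_op T (\<lambda>i j. \<Sum>g\<in>carrier M. a g * c g i j) w"
  proof
    fix j
    have "linear_extension M act a w j =
        (\<Sum>g\<in>carrier M. a g * (if j \<in> T then \<Sum>i\<in>T. w i * c g i j else 0))"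
      using assms w by (auto simp: linear_extension_def sum_fun_apply cscale_def intro!: sum.cong)
    moreover have "(\<Sum>g\<in>carrier M. a g * (\<Sum>i\<in>T. w i * c g i j)) =
        (\<Sum>i\<in>T. w i * (\<Sum>g\<in>carrier M. a g * c g i j))"
      by (simp add: sum_distrib_left mult.left_commute) (rule sum.swap)
    ultimately show "restrict (linear_extension M act a) (supported T) w j =
        matrix_op T (\<lambda>i j. \<Sum>g\<in>carrier M. a g * c g i j) w j"
      using w by (simp add: matrix_op_def)
  qed
qed (simp_all add: matrix_op_def)

section \<open>A basis of the half power\<close>

definition last_tuples :: "nat \<Rightarrow> nat \<Rightarrow> (nat \<Rightarrow> nat) set" where
  "last_tuples n k = {i \<in> tuples n (Suc k). i k = n - 1}"

lemma finite_tuples: "finite (tuples n m)"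
  unfolding tuples_def by (intro finite_PiE) auto

lemma finite_last_tuples: "finite (last_tuples n k)"
  unfolding last_tuples_def using finite_tuples by auto

lemma last_tuplesD:
  assumes "i \<in> last_tuples n k"
  shows "i \<in> tuples n (Suc k)" "i k = n - 1" "\<And>r. r < Suc k \<Longrightarrow> i r < n"
    "\<And>r. \<not> r < Suc k \<Longrightarrow> i r = undefined"
  using assms by (auto simp: last_tuples_def tuples_def PiE_iff extensional_def)

lemma last_tuplesI:
  assumes "\<And>r. r < Suc k \<Longrightarrow> i r < n" "i k = n - 1" "\<And>r. \<not> r < Suc k \<Longrightarrow> i r = undefined"
  shows "i \<in> last_tuples n k"
  using assms by (auto simp: last_tuples_def tuples_def PiE_iff extensional_def)

lemma last_tuples_eqI:
  assumes "i \<in> last_tuples n k" "j \<in> last_tuples n k" "\<And>r. r < Suc k \<Longrightarrow> i r = j r"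
  shows "i = j"
  using assms last_tuplesD(4) by (metis ext)

lemma half_power_eq_supported:
  assumes "n > 0"
  shows "half_power n k = supported (last_tuples n k)"
proof -
  have last: "unit_vec n (n - 1) $ i k = (0 :: complex)" if "i \<in> tuples n (Suc k)" "i k \<noteq> n - 1" for i
    using that assms by (auto simp: tuples_def PiE_iff unit_vec_def)
  show ?thesis
  proof (intro equalityI subsetI)
    fix w assume "w \<in> half_power n k"
    then obtain t where "w = tensor_vec n k t (unit_vec n (n - 1))"
      by (auto simp: half_power_def)
    then show "w \<in> supported (last_tuples n k)"
      using last by (auto simp: supported_def tensor_vec_def last_tuples_def)
  next
    fix w assume w: "w \<in> supported (last_tuples n k)"
    define t where "t i = (if i \<in> tuples n k then w (i(k := n - 1)) else 0)" for i
    have "t \<in> tensor_power n k" by (simp add: tensor_power_def t_def)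
    moreover have "w = tensor_vec n k t (unit_vec n (n - 1))"
    proof
      fix i
      show "w i = tensor_vec n k t (unit_vec n (n - 1)) i"
      proof (cases "i \<in> last_tuples n k")
        case True
        then have "restrict i {..<k} \<in> tuples n k" "(restrict i {..<k})(k := n - 1) = i"
          by (auto simp: last_tuples_def tuples_def PiE_iff extensional_def fun_eq_iff
              less_Suc_eq)
        then show ?thesis using True assms
          by (auto simp: tensor_vec_def t_def last_tuples_def)
      next
        case False
        then show ?thesis using w last
          by (auto simp: supported_def tensor_vec_def last_tuples_def)
      qed
    qed
    ultimately show "w \<in> half_power n k" by (auto simp: half_power_def)
  qed
qed

section \<open>Two mutually commuting kinds of matrices\<close>

text \<open>The graph of the relation that sends the value of \<open>i\<close> at each position to the value of \<open>j\<close> there.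
  It is a partial bijection if and only if \<open>same_kernel\<close> holds.\<close>

definition pairs :: "nat \<Rightarrow> (nat \<Rightarrow> nat) \<Rightarrow> (nat \<Rightarrow> nat) \<Rightarrow> (nat \<times> nat) set" where
  "pairs m i j = (\<lambda>r. (i r, j r)) ` {..<m}"

text \<open>This says that \<open>(i, j)\<close> and \<open>(i', j')\<close> induce the same partition of the \<open>2 m\<close> vertices of a
  diagram; see \<open>kernel_diagram_eq_iff\<close>.\<close>

definition same_equalities ::
  "nat \<Rightarrow> (nat \<Rightarrow> nat) \<Rightarrow> (nat \<Rightarrow> nat) \<Rightarrow> (nat \<Rightarrow> nat) \<Rightarrow> (nat \<Rightarrow> nat) \<Rightarrow> bool" where
  "same_equalities m i j i' j' \<longleftrightarrow> (\<forall>r<m. \<forall>s<m.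
    (i r = i s \<longleftrightarrow> i' r = i' s) \<and> (i r = j s \<longleftrightarrow> i' r = j' s) \<and> (j r = j s \<longleftrightarrow> j' r = j' s))"

definition same_kernel :: "nat \<Rightarrow> (nat \<Rightarrow> nat) \<Rightarrow> (nat \<Rightarrow> nat) \<Rightarrow> bool" where
  "same_kernel m i j \<longleftrightarrow> (\<forall>r<m. \<forall>s<m. i r = i s \<longleftrightarrow> j r = j s)"

definition same_image :: "nat \<Rightarrow> (nat \<Rightarrow> nat) \<Rightarrow> (nat \<Rightarrow> nat) \<Rightarrow> bool" where
  "same_image m i j \<longleftrightarrow> i ` {..<m} = j ` {..<m}"

text \<open>The diagram whose blocks are the classes of vertices with equal labels has only propagating blocks
  if and only if \<open>same_image\<close> holds. So these matrices are the linear combinations of the indicator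
  matrices of such diagrams.\<close>

definition partition_type ::
  "nat \<Rightarrow> (nat \<Rightarrow> nat) set \<Rightarrow> ((nat \<Rightarrow> nat) \<Rightarrow> (nat \<Rightarrow> nat) \<Rightarrow> complex) \<Rightarrow> bool" where
  "partition_type m T F \<longleftrightarrow>
    (\<forall>i\<in>T. \<forall>j\<in>T. \<not> same_image m i j \<longrightarrow> F i j = 0) \<and>
    (\<forall>i\<in>T. \<forall>j\<in>T. \<forall>i'\<in>T. \<forall>j'\<in>T.
      same_image m i j \<and> same_image m i' j' \<and> same_equalities m i j i' j' \<longrightarrow> F i j = F i' j')"

text \<open>These matrices are the linear combinations of the indicator matrices of the partial bijections;
  the one of \<open>\<sigma>\<close> sends \<open>i\<close> to \<open>\<sigma> \<circ> i\<close> if the domain of \<open>\<sigma>\<close> is exactly the set of values of \<open>i\<close>, and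
  to 0 otherwise.\<close>

definition bijection_type ::
  "nat \<Rightarrow> (nat \<Rightarrow> nat) set \<Rightarrow> ((nat \<Rightarrow> nat) \<Rightarrow> (nat \<Rightarrow> nat) \<Rightarrow> complex) \<Rightarrow> bool" where
  "bijection_type m T G \<longleftrightarrow>
    (\<forall>i\<in>T. \<forall>j\<in>T. \<not> same_kernel m i j \<longrightarrow> G i j = 0) \<and>
    (\<forall>i\<in>T. \<forall>j\<in>T. \<forall>i'\<in>T. \<forall>j'\<in>T.
      same_kernel m i j \<and> same_kernel m i' j' \<and> pairs m i j = pairs m i' j' \<longrightarrow> G i j = G i' j')"

lemma same_image_sym: "same_image m i j \<longleftrightarrow> same_image m j i"
  by (auto simp: same_image_def)

lemma same_kernel_sym: "same_kernel m i j \<longleftrightarrow> same_kernel m j i"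
  by (auto simp: same_kernel_def)

text \<open>If \<open>\<sigma>\<close> is the partial bijection with \<open>j = \<sigma> \<circ> l\<close> and \<open>i\<close> has the same values as \<open>l\<close>, then this is
  \<open>\<sigma> \<circ> i\<close>. It is the fourth corner of a square whose other corners are \<open>i\<close>, \<open>l\<close> and \<open>j\<close>.\<close>

definition fourth_corner :: "nat \<Rightarrow> (nat \<Rightarrow> nat) \<Rightarrow> (nat \<Rightarrow> nat) \<Rightarrow> (nat \<Rightarrow> nat) \<Rightarrow> nat \<Rightarrow> nat" where
  "fourth_corner m i l j r = (if r < m then j (SOME s. s < m \<and> l s = i r) else undefined)"

lemma fourth_corner_eq:
  assumes "same_image m i l" "same_kernel m l j" "r < m" "s < m" "l s = i r"
  shows "fourth_corner m i l j r = j s"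
proof -
  have "(SOME s. s < m \<and> l s = i r) < m \<and> l (SOME s. s < m \<and> l s = i r) = i r"
    by (rule someI[where x = s]) (use assms in auto)
  then have "j (SOME s. s < m \<and> l s = i r) = j s"
    using assms(2,4,5) unfolding same_kernel_def by metis
  then show ?thesis using assms(3) by (simp add: fourth_corner_def)
qed

lemma same_imageE:
  assumes "same_image m i l" "r < m"
  obtains s where "s < m" "l s = i r"
proof -
  have "i r \<in> l ` {..<m}" using assms by (auto simp: same_image_def)
  then show ?thesis using that by auto
qed

lemma same_imageI:
  assumes "\<And>r. r < m \<Longrightarrow> \<exists>s<m. i r = j s" "\<And>r. r < m \<Longrightarrow> \<exists>s<m. j r = i s"
  shows "same_image m i j"
  unfolding same_image_def using assms by fastforce

text \<open>Opposite sides of the square carry the same data: the passages from \<open>i\<close> to \<open>l'\<close> and from \<open>l\<close> to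
  \<open>j\<close> are given by the same bijection, and \<open>(l', j)\<close> arises from \<open>(i, l)\<close> by relabelling. The
  construction is an involution in the sense that it recovers \<open>l\<close> from \<open>l'\<close> when \<open>i\<close> and \<open>j\<close> are
  exchanged.\<close>

lemma fourth_corner_props:
  assumes i: "i \<in> last_tuples n k" and l: "l \<in> last_tuples n k" and j: "j \<in> last_tuples n k"
    and im: "same_image (Suc k) i l" and ker: "same_kernel (Suc k) l j"
  defines "l' \<equiv> fourth_corner (Suc k) i l j"
  shows "l' \<in> last_tuples n k" "same_kernel (Suc k) i l'" "same_image (Suc k) l' j"
    "fourth_corner (Suc k) j l' i = l" "pairs (Suc k) i l' = pairs (Suc k) l j"
    "same_equalities (Suc k) i l l' j"
proof -
  have val: "l' r = j s" if "r < Suc k" "s < Suc k" "l s = i r" for r s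
    unfolding l'_def using fourth_corner_eq[OF im ker] that by blast
  have ex: "\<exists>s<Suc k. l s = i r \<and> l' r = j s" if "r < Suc k" for r
    using same_imageE[OF im that] val that by metis
  have ex': "\<exists>r<Suc k. l s = i r \<and> l' r = j s" if "s < Suc k" for s
    using same_imageE[OF im[unfolded same_image_sym[of _ i]] that] val that by metis
  note K = ker[unfolded same_kernel_def, rule_format]
  show T: "l' \<in> last_tuples n k"
  proof (rule last_tuplesI)
    show "l' r < n" if "r < Suc k" for r using ex[OF that] last_tuplesD(3)[OF j] by auto
    show "l' k = n - 1" using val[of k k] last_tuplesD(2)[OF i] last_tuplesD(2)[OF l]
        last_tuplesD(2)[OF j] by simp
    show "l' r = undefined" if "\<not> r < Suc k" for r using that by (simp add: l'_def fourth_corner_def)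
  qed
  show sk: "same_kernel (Suc k) i l'"
    unfolding same_kernel_def
  proof (intro allI impI)
    fix r s assume rs: "r < Suc k" "s < Suc k"
    then show "(i r = i s) = (l' r = l' s)" using ex[OF rs(1)] ex[OF rs(2)] K by metis
  qed
  show si: "same_image (Suc k) l' j"
    using ex ex' by (intro same_imageI) metis+
  show "fourth_corner (Suc k) j l' i = l"
  proof
    fix s
    show "fourth_corner (Suc k) j l' i s = l s"
    proof (cases "s < Suc k")
      case True
      then obtain r where r: "r < Suc k" "l s = i r" "l' r = j s" using ex' by blast
      then show ?thesis
        using fourth_corner_eq[OF si[unfolded same_image_sym[of _ l']] sk[unfolded same_kernel_sym[of _ i]] True r(1,3)]
        by simp
    next
      case False
      then show ?thesis using last_tuplesD(4)[OF l] by (simp add: fourth_corner_def)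
    qed
  qed
  have "\<exists>s<Suc k. (i r, l' r) = (l s, j s)" if "r < Suc k" for r using ex[OF that] by auto
  moreover have "\<exists>r<Suc k. (i r, l' r) = (l s, j s)" if "s < Suc k" for s using ex'[OF that] by auto
  ultimately show "pairs (Suc k) i l' = pairs (Suc k) l j"
    unfolding pairs_def by (auto simp: image_iff Bex_def) metis+
  show "same_equalities (Suc k) i l l' j"
    unfolding same_equalities_def
  proof (intro allI impI conjI)
    fix r s assume rs: "r < Suc k" "s < Suc k"
    show "(i r = i s) = (l' r = l' s)" using sk rs by (auto simp: same_kernel_def)
    show "(l r = l s) = (j r = j s)" using K rs by blast
    show "(i r = l s) = (l' r = j s)" using ex[OF rs(1)] K rs by metis
  qed
qed

text \<open>Passing to the fourth corner is a bijection between the nonzero terms of the two sums over the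
  middle index, and it preserves the terms.\<close>

lemma types_commute:
  assumes F: "partition_type (Suc k) (last_tuples n k) F"
    and G: "bijection_type (Suc k) (last_tuples n k) G"
    and i: "i \<in> last_tuples n k" and j: "j \<in> last_tuples n k"
  shows "matrix_mult (last_tuples n k) F G i j = matrix_mult (last_tuples n k) G F i j"
proof -
  let ?T = "last_tuples n k" and ?m = "Suc k"
  let ?A = "{l\<in>?T. same_image ?m i l \<and> same_kernel ?m l j}"
  let ?B = "{l\<in>?T. same_kernel ?m i l \<and> same_image ?m l j}"
  have "matrix_mult ?T F G i j = (\<Sum>l\<in>?A. F i l * G l j)"
    unfolding matrix_mult_def
    by (intro sum.mono_neutral_right finite_last_tuples)
      (use F G i j in \<open>auto simp: partition_type_def bijection_type_def\<close>)
  also have "\<dots> = (\<Sum>l'\<in>?B. G i l' * F l' j)"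
  proof (rule sum.reindex_bij_witness[where j = "\<lambda>l. fourth_corner ?m i l j" and i = "\<lambda>l'. fourth_corner ?m j l' i"])
    fix l assume "l \<in> ?A"
    then have l: "l \<in> ?T" "same_image ?m i l" "same_kernel ?m l j" by auto
    note p = fourth_corner_props[OF i l(1) j l(2,3)]
    show "fourth_corner ?m j (fourth_corner ?m i l j) i = l" by (rule p(4))
    show "fourth_corner ?m i l j \<in> ?B" using p by simp
    have "G i (fourth_corner ?m i l j) = G l j"
      using G i j l p unfolding bijection_type_def by blast
    moreover have "F i l = F (fourth_corner ?m i l j) j"
      using F i j l p unfolding partition_type_def by blast
    ultimately show "G i (fourth_corner ?m i l j) * F (fourth_corner ?m i l j) j = F i l * G l j" by simp
  next
    fix l' assume "l' \<in> ?B"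
    then have l: "l' \<in> ?T" "same_image ?m j l'" "same_kernel ?m l' i"
      using same_image_sym same_kernel_sym by blast+
    note p = fourth_corner_props[OF j l(1) i l(2,3)]
    show "fourth_corner ?m i (fourth_corner ?m j l' i) j = l'" by (rule p(4))
    show "fourth_corner ?m j l' i \<in> ?A" using p same_image_sym same_kernel_sym by blast
  qed
  also have "\<dots> = matrix_mult ?T G F i j"
    unfolding matrix_mult_def
    by (intro sum.mono_neutral_left finite_last_tuples)
      (use F G i j in \<open>auto simp: partition_type_def bijection_type_def\<close>)
  finally show ?thesis .
qed

text \<open>Together with \<open>pairs_eq_iff_left\<close>: in the indicator matrix of a partial bijection, each row and
  each column has at most one nonzero entry.\<close>

lemma pairs_eq_iff_right:
  assumes "i \<in> last_tuples n k" "l \<in> last_tuples n k" "i' \<in> last_tuples n k"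
    and "same_kernel (Suc k) i i'"
  shows "pairs (Suc k) i l = pairs (Suc k) i i' \<longleftrightarrow> l = i'"
proof
  assume eq: "pairs (Suc k) i l = pairs (Suc k) i i'"
  have "l r = i' r" if "r < Suc k" for r
  proof -
    have "(i r, l r) \<in> pairs (Suc k) i i'" using that unfolding eq[symmetric] by (auto simp: pairs_def)
    then show ?thesis using assms(4) that by (auto simp: pairs_def same_kernel_def)
  qed
  then show "l = i'" using assms last_tuples_eqI by blast
qed simp

lemma pairs_flip: "pairs m i j = prod.swap ` pairs m j i"
  by (auto simp: pairs_def image_image)

lemma pairs_swap: "pairs m i j = pairs m i' j' \<longleftrightarrow> pairs m j i = pairs m j' i'"
  by (metis pairs_flip)

lemma pairs_eq_iff_left:
  assumes "j \<in> last_tuples n k" "l \<in> last_tuples n k" "j' \<in> last_tuples n k"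
    and "same_kernel (Suc k) j j'"
  shows "pairs (Suc k) l j' = pairs (Suc k) j j' \<longleftrightarrow> l = j"
  using pairs_eq_iff_right[OF assms(3,2,1)] assms(4) same_kernel_sym pairs_swap by blast

lemma bijection_indicator:
  "bijection_type m T (\<lambda>i j. of_bool (same_kernel m i j \<and> pairs m i j = S))"
  by (auto simp: bijection_type_def)

lemma same_equalities_cong:
  assumes "same_equalities m i j i' j'"
  shows "same_equalities m a b i j \<longleftrightarrow> same_equalities m a b i' j'"
  using assms unfolding same_equalities_def by simp

lemma partition_indicator:
  "partition_type m T (\<lambda>i j. of_bool (same_image m i j \<and> same_equalities m a b i j))"
  unfolding partition_type_def using same_equalities_cong[of m _ _ _ _ a b] by auto

lemma matrix_mult_single_left:
  assumes "finite T" "x \<in> T" "\<And>l. l \<in> T \<Longrightarrow> G i l = of_bool (l = x)"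
  shows "matrix_mult T G F i j = F x j"
proof -
  have "matrix_mult T G F i j = (\<Sum>l\<in>T. if l = x then F l j else 0)"
    unfolding matrix_mult_def using assms(3) by (intro sum.cong) auto
  then show ?thesis using assms(1,2) by simp
qed

lemma matrix_mult_single_right:
  assumes "finite T" "x \<in> T" "\<And>l. l \<in> T \<Longrightarrow> G l j = of_bool (l = x)"
  shows "matrix_mult T F G i j = F i x"
proof -
  have "matrix_mult T F G i j = (\<Sum>l\<in>T. if l = x then F i l else 0)"
    unfolding matrix_mult_def using assms(3) by (intro sum.cong) auto
  then show ?thesis using assms(1,2) by simp
qed

lemma same_kernel_refl: "same_kernel m i i" by (simp add: same_kernel_def)
lemma same_image_refl: "same_image m i i" by (simp add: same_image_def)

lemma pairs_diag: "pairs m i i = pairs m j j \<longleftrightarrow> same_image m i j"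
proof -
  have "pairs m i i = (\<lambda>x. (x, x)) ` i ` {..<m}" for i by (auto simp: pairs_def)
  moreover have "inj (\<lambda>x. (x, x))" by (auto simp: inj_on_def)
  ultimately show ?thesis unfolding same_image_def by (metis inj_image_eq_iff)
qed

lemma pairs_diag_unique:
  assumes "pairs (Suc k) l j = pairs (Suc k) i i" "l \<in> last_tuples n k" "j \<in> last_tuples n k"
  shows "l = j"
proof (rule last_tuples_eqI[OF assms(2,3)])
  fix r assume "r < Suc k"
  then have "(l r, j r) \<in> pairs (Suc k) i i" unfolding assms(1)[symmetric] by (auto simp: pairs_def)
  then show "l r = j r" by (auto simp: pairs_def)
qed

text \<open>The commutation is tested with the indicator matrices of single partial bijections. The identity
  of the set of values of \<open>i\<close> isolates the entry \<open>F i j\<close> on one side, while the other side vanishes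
  unless \<open>j\<close> has the same values. The bijection carrying \<open>i\<close> to \<open>i'\<close>, which also carries \<open>j\<close> to \<open>j'\<close>,
  gives \<open>F i' j'\<close> on one side and \<open>F i j\<close> on the other.\<close>

lemma centralizer_bijection_type:
  assumes comm: "\<And>G i j. bijection_type (Suc k) (last_tuples n k) G \<Longrightarrow>
      i \<in> last_tuples n k \<Longrightarrow> j \<in> last_tuples n k \<Longrightarrow>
      matrix_mult (last_tuples n k) F G i j = matrix_mult (last_tuples n k) G F i j"
  shows "partition_type (Suc k) (last_tuples n k) F"
proof -
  let ?T = "last_tuples n k" and ?m = "Suc k"
  let ?G = "\<lambda>S i j. of_bool (same_kernel ?m i j \<and> pairs ?m i j = S) :: complex"
  have zero: "F i j = 0" if i: "i \<in> ?T" and j: "j \<in> ?T" and ij: "\<not> same_image ?m i j" for i j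
  proof -
    have "?G (pairs ?m i i) i l = of_bool (l = i)" if "l \<in> ?T" for l
      using pairs_eq_iff_right[OF i that i same_kernel_refl] same_kernel_refl by auto
    then have "matrix_mult ?T (?G (pairs ?m i i)) F i j = F i j"
      by (intro matrix_mult_single_left[OF finite_last_tuples i]) auto
    moreover have "?G (pairs ?m i i) l j = 0" if "l \<in> ?T" for l
      using pairs_diag_unique[OF _ that j, of i] ij pairs_diag[of ?m j i] same_image_sym by auto
    then have "matrix_mult ?T F (?G (pairs ?m i i)) i j = 0"
      unfolding matrix_mult_def by (intro sum.neutral) auto
    ultimately show ?thesis using comm[OF bijection_indicator i j] by metis
  qed
  have "F i j = F i' j'" if T: "i \<in> ?T" "j \<in> ?T" "i' \<in> ?T" "j' \<in> ?T"
    and im: "same_image ?m i j" and se: "same_equalities ?m i j i' j'" for i j i' j'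
  proof -
    let ?S = "pairs ?m i i'"
    have k: "same_kernel ?m i i'" "same_kernel ?m j j'"
      using se by (auto simp: same_equalities_def same_kernel_def)
    have S: "?S = pairs ?m j j'"
    proof (intro equalityI subsetI)
      fix p assume "p \<in> ?S"
      then obtain r where r: "r < ?m" "p = (i r, i' r)" by (auto simp: pairs_def)
      then obtain s where s: "s < ?m" "j s = i r" using same_imageE[OF im] by blast
      then have "p = (j s, j' s)"
        using se[unfolded same_equalities_def, rule_format, OF r(1) s(1)] r by simp
      then show "p \<in> pairs ?m j j'" using s(1) by (simp add: pairs_def)
    next
      fix p assume "p \<in> pairs ?m j j'"
      then obtain s where s: "s < ?m" "p = (j s, j' s)" by (auto simp: pairs_def)
      then obtain r where r: "r < ?m" "i r = j s"
        using same_imageE[OF im[unfolded same_image_sym[of _ i]]] by blast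
      then have "p = (i r, i' r)"
        using se[unfolded same_equalities_def, rule_format, OF r(1) s(1)] s by simp
      then show "p \<in> ?S" using r(1) by (simp add: pairs_def)
    qed
    have "?G ?S i l = of_bool (l = i')" if "l \<in> ?T" for l
      using pairs_eq_iff_right[OF T(1) that T(3) k(1)] k by auto
    then have "matrix_mult ?T (?G ?S) F i j' = F i' j'"
      by (intro matrix_mult_single_left[OF finite_last_tuples T(3)]) auto
    moreover have "?G ?S l j' = of_bool (l = j)" if "l \<in> ?T" for l
      using pairs_eq_iff_left[OF T(2) that T(4) k(2)] k S by auto
    then have "matrix_mult ?T F (?G ?S) i j' = F i j"
      by (intro matrix_mult_single_right[OF finite_last_tuples T(2)]) auto
    ultimately show ?thesis using comm[OF bijection_indicator T(1,4)] by metis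
  qed
  with zero show ?thesis unfolding partition_type_def by blast
qed

text \<open>The dual argument, in which the indicator matrices of single diagrams replace those of partial
  bijections. The kernel diagram of \<open>(i, i)\<close> isolates \<open>G i j\<close>, and the common kernel diagram of
  \<open>(i, i')\<close> and \<open>(j, j')\<close> gives \<open>G i' j'\<close> on one side and \<open>G i j\<close> on the other.\<close>

lemma centralizer_partition_type:
  assumes comm: "\<And>F i j. partition_type (Suc k) (last_tuples n k) F \<Longrightarrow>
      i \<in> last_tuples n k \<Longrightarrow> j \<in> last_tuples n k \<Longrightarrow>
      matrix_mult (last_tuples n k) G F i j = matrix_mult (last_tuples n k) F G i j"
  shows "bijection_type (Suc k) (last_tuples n k) G"
proof -
  let ?T = "last_tuples n k" and ?m = "Suc k"
  let ?F = "\<lambda>a b i j. of_bool (same_image ?m i j \<and> same_equalities ?m a b i j) :: complex"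
  have diag: "l = j" if "same_equalities ?m i i l j" "l \<in> ?T" "j \<in> ?T" for i l j
    using that by (intro last_tuples_eqI[OF that(2,3)]) (auto simp: same_equalities_def)
  have zero: "G i j = 0" if i: "i \<in> ?T" and j: "j \<in> ?T" and ij: "\<not> same_kernel ?m i j" for i j
  proof -
    have "?F i i i l = of_bool (l = i)" if "l \<in> ?T" for l
      using diag[OF _ i that, of i] same_image_refl by (auto simp: same_equalities_def)
    then have "matrix_mult ?T (?F i i) G i j = G i j"
      by (intro matrix_mult_single_left[OF finite_last_tuples i]) auto
    moreover have "?F i i l j = 0" if "l \<in> ?T" for l
      using diag[OF _ that j, of i] ij by (auto simp: same_equalities_def same_kernel_def)
    then have "matrix_mult ?T G (?F i i) i j = 0"
      unfolding matrix_mult_def by (intro sum.neutral) auto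
    ultimately show ?thesis using comm[OF partition_indicator i j] by metis
  qed
  have "G i j = G i' j'" if T: "i \<in> ?T" "j \<in> ?T" "i' \<in> ?T" "j' \<in> ?T"
    and k: "same_kernel ?m i j" and p: "pairs ?m i j = pairs ?m i' j'" for i j i' j'
  proof -
    have 1: "\<exists>s<?m. i r = i' s \<and> j r = j' s" if "r < ?m" for r
    proof -
      have "(i r, j r) \<in> pairs ?m i' j'" using that unfolding p[symmetric] by (auto simp: pairs_def)
      then show ?thesis by (auto simp: pairs_def)
    qed
    have 2: "\<exists>s<?m. i' r = i s \<and> j' r = j s" if "r < ?m" for r
    proof -
      have "(i' r, j' r) \<in> pairs ?m i j" using that unfolding p by (auto simp: pairs_def)
      then show ?thesis by (auto simp: pairs_def)
    qed
    have im: "same_image ?m i i'" "same_image ?m j j'"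
      by (rule same_imageI; use 1 2 in blast)+
    note K = k[unfolded same_kernel_def, rule_format]
    have se: "same_equalities ?m i i' j j'"
      unfolding same_equalities_def
    proof (intro allI impI conjI)
      fix r s assume rs: "r < ?m" "s < ?m"
      show "(i r = i s) = (j r = j s)" using K rs by blast
      show "(i r = i' s) = (j r = j' s)" using 2[OF rs(2)] K rs by metis
      show "(i' r = i' s) = (j' r = j' s)" using 2[OF rs(1)] 2[OF rs(2)] K by metis
    qed
    have "l = i'" if l: "l \<in> ?T" and e: "same_equalities ?m i i' i l" for l
    proof (rule last_tuples_eqI[OF l T(3)])
      fix s assume s: "s < ?m"
      then obtain r where r: "r < ?m" "i' s = i r" using 2 by blast
      then show "l s = i' s" using e[unfolded same_equalities_def, rule_format, OF r(1) s] by simp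
    qed
    then have "?F i i' i l = of_bool (l = i')" if "l \<in> ?T" for l
      using that im by (auto simp: same_equalities_def)
    then have "matrix_mult ?T (?F i i') G i j' = G i' j'"
      by (intro matrix_mult_single_left[OF finite_last_tuples T(3)]) auto
    moreover have "l = j" if l: "l \<in> ?T" and e: "same_equalities ?m i i' l j'" for l
    proof (rule last_tuples_eqI[OF l T(2)])
      fix r assume r: "r < ?m"
      then obtain s where s: "s < ?m" "i r = i' s" "j r = j' s" using 1 by blast
      then show "l r = j r" using e[unfolded same_equalities_def, rule_format, OF r s(1)] by simp
    qed
    then have "same_image ?m l j' \<and> same_equalities ?m i i' l j' \<longleftrightarrow> l = j" if "l \<in> ?T" for l
      using that im(2) se by blast
    then have "?F i i' l j' = of_bool (l = j)" if "l \<in> ?T" for l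
      using that by presburger
    then have "matrix_mult ?T G (?F i i') i j' = G i j"
      by (intro matrix_mult_single_right[OF finite_last_tuples T(2)]) auto
    ultimately show ?thesis using comm[OF partition_indicator T(1,4)] by metis
  qed
  with zero show ?thesis unfolding bijection_type_def by blast
qed

section \<open>The operators of diagrams\<close>

lemma I_half_iff:
  "d \<in> carrier (I_half_monoid k) \<longleftrightarrow> partition_on (vertices (Suc k)) d \<and>
    (\<forall>B\<in>d. propagating B) \<and> (\<exists>B\<in>d. Top k \<in> B \<and> Bot k \<in> B)"
  by (auto simp: I_half_monoid_def I_monoid_def diagram_monoid_def)

lemma finite_I_half: "finite (carrier (I_half_monoid k))"
  by (rule finite_subset[OF _ finite_diagrams[of "Suc k"]])
    (auto simp: I_half_iff diagram_monoid_def)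

text \<open>This keeps the sums over finer diagrams inside \<open>I_{k+1/2}\<close>: a diagram outside it has no finer
  diagram in it.\<close>

lemma I_half_coarser:
  assumes "d \<in> carrier (I_half_monoid k)" "refines (vertices (Suc k)) d e"
  shows "e \<in> carrier (I_half_monoid k)"
proof -
  have d: "partition_on (vertices (Suc k)) d" "\<forall>B\<in>d. propagating B"
      "\<exists>B\<in>d. Top k \<in> B \<and> Bot k \<in> B"
    and e: "partition_on (vertices (Suc k)) e" "\<forall>X\<in>d. \<exists>Y\<in>e. X \<subseteq> Y"
    using assms by (auto simp: I_half_iff refines_def)
  have "propagating Y" if Y: "Y \<in> e" for Y
  proof -
    obtain v where v: "v \<in> Y" using Y partition_onD3[OF e(1)] by (cases "Y = {}") auto
    then obtain X where X: "X \<in> d" "v \<in> X"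
      using Y partition_onD1[OF e(1)] partition_onD1[OF d(1)] by auto
    then obtain Y' where Y': "Y' \<in> e" "X \<subseteq> Y'" using e by blast
    then have "Y' = Y" using partition_onD2[OF e(1)] X v Y by (auto simp: disjoint_def)
    moreover have "propagating X" using d(2) X by blast
    ultimately show ?thesis using Y'(2) unfolding propagating_def by blast
  qed
  moreover have "\<exists>B\<in>e. Top k \<in> B \<and> Bot k \<in> B" using d(3) e(2) by (meson subsetD)
  ultimately show ?thesis using e by (simp add: I_half_iff)
qed

lemma vertices_cases:
  assumes "v \<in> vertices m"
  obtains r where "r < m" "v = Top r" | r where "r < m" "v = Bot r"
  using assms by (auto simp: vertices_def)

lemma vertices_simps: "Top r \<in> vertices m \<longleftrightarrow> r < m" "Bot r \<in> vertices m \<longleftrightarrow> r < m"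
  "Mid r \<notin> vertices m"
  by (auto simp: vertices_def)

text \<open>Each block contains a vertex of the top row.\<close>

lemma card_I_half:
  assumes d: "d \<in> carrier (I_half_monoid k)"
  shows "card d \<le> Suc k"
proof -
  have p: "partition_on (vertices (Suc k)) d" using d by (simp add: I_half_iff)
  have "\<exists>r<Suc k. Top r \<in> B" if "B \<in> d" for B
  proof -
    have "propagating B" using d that by (simp add: I_half_iff)
    then obtain r where "Top r \<in> B" unfolding propagating_def by blast
    moreover have "B \<subseteq> vertices (Suc k)" using p that partition_onD1 by blast
    ultimately show ?thesis using vertices_simps(1) by blast
  qed
  then obtain f where f: "\<And>B. B \<in> d \<Longrightarrow> f B < Suc k \<and> Top (f B) \<in> B" by metis
  have "inj_on f d"
  proof (rule inj_onI)
    fix B C assume BC: "B \<in> d" "C \<in> d" "f B = f C"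
    then have "Top (f B) \<in> B \<inter> C" using f by fastforce
    then show "B = C" using partition_onD2[OF p] BC unfolding disjoint_def by blast
  qed
  then show ?thesis using card_inj_on_le[of f d "{..<Suc k}"] f by auto
qed

definition kernel_diagram :: "nat \<Rightarrow> (nat \<Rightarrow> nat) \<Rightarrow> (nat \<Rightarrow> nat) \<Rightarrow> diagram" where
  "kernel_diagram m i j =
    (\<lambda>v. {u \<in> vertices m. vertex_label i j u = vertex_label i j v}) ` vertices m"

lemma partition_on_kernel_diagram: "partition_on (vertices m) (kernel_diagram m i j)"
  by (rule partition_onI) (auto simp: kernel_diagram_def disjnt_def)

lemma diagram_coeff_nonzeroD:
  assumes "diagram_coeff d i j \<noteq> 0" "B \<in> d" "u \<in> B" "v \<in> B"
  shows "vertex_label i j u = vertex_label i j v"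
  using assms unfolding diagram_coeff_def by meson

lemma diagram_coeff_eq_refines:
  assumes "partition_on (vertices m) d"
  shows "diagram_coeff d i j = of_bool (refines (vertices m) d (kernel_diagram m i j))"
proof -
  have "(\<forall>B\<in>d. \<forall>u\<in>B. \<forall>v\<in>B. vertex_label i j u = vertex_label i j v) \<longleftrightarrow>
      (\<forall>B\<in>d. \<exists>Y\<in>kernel_diagram m i j. B \<subseteq> Y)" (is "?L \<longleftrightarrow> ?R")
  proof
    assume L: ?L
    show ?R
    proof
      fix B assume B: "B \<in> d"
      then obtain v where v: "v \<in> B" using partition_onD3[OF assms] by (cases "B = {}") auto
      have sub: "B \<subseteq> vertices m" using B partition_onD1[OF assms] by auto
      then have "B \<subseteq> {u \<in> vertices m. vertex_label i j u = vertex_label i j v}"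
        using sub L[rule_format, OF B _ v] by blast
      moreover have "{u \<in> vertices m. vertex_label i j u = vertex_label i j v} \<in> kernel_diagram m i j"
        unfolding kernel_diagram_def using v sub by (intro imageI) auto
      ultimately show "\<exists>Y\<in>kernel_diagram m i j. B \<subseteq> Y" by blast
    qed
  next
    assume R: ?R
    show ?L
    proof (intro ballI)
      fix B u v assume B: "B \<in> d" "u \<in> B" "v \<in> B"
      then obtain w where "B \<subseteq> {u \<in> vertices m. vertex_label i j u = vertex_label i j w}"
        using R unfolding kernel_diagram_def by blast
      then have "vertex_label i j u = vertex_label i j w" "vertex_label i j v = vertex_label i j w"
        using B(2,3) by blast+
      then show "vertex_label i j u = vertex_label i j v" by simp
    qed
  qed
  then show ?thesis
    using assms partition_on_kernel_diagram by (simp add: diagram_coeff_def refines_def)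
qed

lemma same_equalities_iff_labels:
  "same_equalities m i j i' j' \<longleftrightarrow> (\<forall>u\<in>vertices m. \<forall>v\<in>vertices m.
    vertex_label i j u = vertex_label i j v \<longleftrightarrow> vertex_label i' j' u = vertex_label i' j' v)"
proof
  assume se: "same_equalities m i j i' j'"
  show "\<forall>u\<in>vertices m. \<forall>v\<in>vertices m.
    vertex_label i j u = vertex_label i j v \<longleftrightarrow> vertex_label i' j' u = vertex_label i' j' v"
  proof (intro ballI)
    fix u v assume "u \<in> vertices m" "v \<in> vertices m"
    then show "vertex_label i j u = vertex_label i j v \<longleftrightarrow> vertex_label i' j' u = vertex_label i' j' v"
      by (elim vertices_cases)
        (use se[unfolded same_equalities_def, rule_format] in \<open>simp_all, metis+\<close>)
  qed
next
  assume R: "\<forall>u\<in>vertices m. \<forall>v\<in>vertices m.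
    vertex_label i j u = vertex_label i j v \<longleftrightarrow> vertex_label i' j' u = vertex_label i' j' v"
  show "same_equalities m i j i' j'"
    unfolding same_equalities_def
  proof (intro allI impI conjI)
    fix r s assume "r < m" "s < m"
    then have V: "Top r \<in> vertices m" "Top s \<in> vertices m" "Bot r \<in> vertices m" "Bot s \<in> vertices m"
      by (auto simp: vertices_def)
    show "(i r = i s) = (i' r = i' s)" using R[rule_format, OF V(1,2)] by simp
    show "(i r = j s) = (i' r = j' s)" using R[rule_format, OF V(1,4)] by simp
    show "(j r = j s) = (j' r = j' s)" using R[rule_format, OF V(3,4)] by simp
  qed
qed

lemma kernel_diagram_eq_iff:
  "kernel_diagram m i j = kernel_diagram m i' j' \<longleftrightarrow> same_equalities m i j i' j'"
proof
  assume eq: "kernel_diagram m i j = kernel_diagram m i' j'"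
  show "same_equalities m i j i' j'"
    unfolding same_equalities_iff_labels
  proof (intro ballI)
    fix u v assume uv: "u \<in> vertices m" "v \<in> vertices m"
    let ?B = "{u \<in> vertices m. vertex_label i j u = vertex_label i j v}"
    have "?B \<in> kernel_diagram m i j" unfolding kernel_diagram_def by (intro imageI uv)
    then have "?B \<in> kernel_diagram m i' j'" unfolding eq .
    then obtain w where w: "?B = {u \<in> vertices m. vertex_label i' j' u = vertex_label i' j' w}"
      by (auto simp: kernel_diagram_def)
    have "v \<in> ?B" using uv by simp
    then have "vertex_label i' j' v = vertex_label i' j' w" unfolding w by simp
    moreover have "u \<in> ?B \<longleftrightarrow> vertex_label i' j' u = vertex_label i' j' w" unfolding w using uv by simp
    ultimately show "(vertex_label i j u = vertex_label i j v) =
        (vertex_label i' j' u = vertex_label i' j' v)" using uv by simp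
  qed
next
  assume "same_equalities m i j i' j'"
  then show "kernel_diagram m i j = kernel_diagram m i' j'"
    unfolding same_equalities_iff_labels kernel_diagram_def by (intro image_cong refl Collect_cong) auto
qed

lemma kernel_diagram_I_half:
  assumes i: "i \<in> last_tuples n k" and j: "j \<in> last_tuples n k" and im: "same_image (Suc k) i j"
  shows "kernel_diagram (Suc k) i j \<in> carrier (I_half_monoid k)"
proof -
  have "propagating B" if B: "B \<in> kernel_diagram (Suc k) i j" for B
  proof -
    obtain v where v: "v \<in> vertices (Suc k)"
      and B_eq: "B = {u \<in> vertices (Suc k). vertex_label i j u = vertex_label i j v}"
      using B by (auto simp: kernel_diagram_def)
    obtain r where r: "r < Suc k" "i r = vertex_label i j v"
      using v same_imageE[OF im[unfolded same_image_sym[of _ i]]] by (elim vertices_cases) auto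
    obtain s where s: "s < Suc k" "j s = vertex_label i j v"
      using v same_imageE[OF im] by (elim vertices_cases) auto
    have "Top r \<in> B" "Bot s \<in> B" using r s by (auto simp: B_eq vertices_def)
    then show ?thesis by (auto simp: propagating_def)
  qed
  moreover have "\<exists>B\<in>kernel_diagram (Suc k) i j. Top k \<in> B \<and> Bot k \<in> B"
    using last_tuplesD(2)[OF i] last_tuplesD(2)[OF j]
    by (auto simp: kernel_diagram_def vertices_simps intro!: bexI[where x = "Top k"])
  ultimately show ?thesis by (simp add: I_half_iff partition_on_kernel_diagram)
qed

lemma card_kernel_diagram:
  assumes "i \<in> last_tuples n k" "j \<in> last_tuples n k"
  shows "card (kernel_diagram (Suc k) i j) \<le> n"
proof -
  have "kernel_diagram (Suc k) i j = (\<lambda>c. {u \<in> vertices (Suc k). vertex_label i j u = c}) `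
      vertex_label i j ` vertices (Suc k)"
    by (auto simp: kernel_diagram_def image_image)
  then have "card (kernel_diagram (Suc k) i j) \<le> card (vertex_label i j ` vertices (Suc k))"
    by (simp add: card_image_le finite_vertices)
  also have "\<dots> \<le> card {..<n}"
    using last_tuplesD(3)[OF assms(1)] last_tuplesD(3)[OF assms(2)]
    by (intro card_mono) (auto simp: vertices_def)
  finally show ?thesis by simp
qed

text \<open>With at least as many labels as blocks, the blocks can be labelled injectively. The label of the
  block of the last vertices can be made \<open>n - 1\<close> by composing with a transposition.\<close>

lemma kernel_diagram_surj:
  assumes "n > 0" and e: "e \<in> carrier (I_half_monoid k)" and card: "card e \<le> n"
  obtains i j where "i \<in> last_tuples n k" "j \<in> last_tuples n k" "kernel_diagram (Suc k) i j = e"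
proof -
  let ?V = "vertices (Suc k)"
  have p: "partition_on ?V e" using e by (simp add: I_half_iff)
  obtain B0 where B0: "B0 \<in> e" "Top k \<in> B0" "Bot k \<in> B0" using e by (auto simp: I_half_iff)
  have "finite e" using p finite_elements finite_vertices by blast
  then obtain h where h: "inj_on h e" "h ` e \<subseteq> {..<n}"
    using card card_le_inj[of e "{..<n}"] by auto
  \<comment> \<open>The transposition moves the label of the block of the last vertices to \<open>n - 1\<close>.\<close>
  define g where "g = Transposition.transpose (h B0) (n - 1) \<circ> h"
  have g: "inj_on g e" "g B0 = n - 1"
    unfolding g_def by (auto intro!: comp_inj_on h inj_on_subset[OF inj_transpose])
  have gn: "g B < n" if "B \<in> e" for B
    using h that B0 assms(1) by (auto simp: g_def Transposition.transpose_def)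
  define bl where "bl v = (THE B. B \<in> e \<and> v \<in> B)" for v
  have bl_eq: "bl v = B" if "B \<in> e" "v \<in> B" for v B
    unfolding bl_def using that partition_onD2[OF p] by (intro the_equality) (auto simp: disjoint_def)
  have bl: "bl v \<in> e" "v \<in> bl v" if v: "v \<in> ?V" for v
  proof -
    obtain B where "B \<in> e" "v \<in> B" using v partition_onD1[OF p] by auto
    then show "bl v \<in> e" "v \<in> bl v" using bl_eq by auto
  qed
  define i where "i r = (if r < Suc k then g (bl (Top r)) else undefined)" for r
  define j where "j r = (if r < Suc k then g (bl (Bot r)) else undefined)" for r
  have lab: "vertex_label i j v = g (bl v)" if "v \<in> ?V" for v
    using that by (elim vertices_cases) (auto simp: i_def j_def)
  have "i \<in> last_tuples n k" "j \<in> last_tuples n k"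
    using gn bl B0 bl_eq g(2) by (auto simp: i_def j_def vertices_simps intro!: last_tuplesI)
  moreover have "kernel_diagram (Suc k) i j = e"
  proof -
    have blk: "{u \<in> ?V. vertex_label i j u = vertex_label i j v} = bl v" if v: "v \<in> ?V" for v
    proof (intro equalityI subsetI)
      fix u assume "u \<in> {u \<in> ?V. vertex_label i j u = vertex_label i j v}"
      then have u: "u \<in> ?V" "g (bl u) = g (bl v)" using lab v by auto
      then have "bl u = bl v" using inj_onD[OF g(1) u(2)] bl v by blast
      then show "u \<in> bl v" using bl(2)[OF u(1)] by simp
    next
      fix u assume u: "u \<in> bl v"
      then have uV: "u \<in> ?V" using bl[OF v] partition_onD1[OF p] by auto
      then show "u \<in> {u \<in> ?V. vertex_label i j u = vertex_label i j v}"
        using lab v bl_eq[OF bl(1)[OF v] u] by simp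
    qed
    have "bl ` ?V = e"
    proof (intro equalityI subsetI)
      fix B assume B: "B \<in> e"
      then obtain v where v: "v \<in> B" using partition_onD3[OF p] by (cases "B = {}") auto
      then have "v \<in> ?V" using B partition_onD1[OF p] by auto
      then show "B \<in> bl ` ?V" using bl_eq[OF B v] by auto
    qed (use bl in auto)
    then show ?thesis unfolding kernel_diagram_def using blk by simp
  qed
  ultimately show ?thesis using that by blast
qed

definition diagram_matrix ::
  "nat \<Rightarrow> (diagram \<Rightarrow> complex) \<Rightarrow> (nat \<Rightarrow> nat) \<Rightarrow> (nat \<Rightarrow> nat) \<Rightarrow> complex" where
  "diagram_matrix k a i j = (\<Sum>d\<in>carrier (I_half_monoid k). a d * diagram_coeff d i j)"

lemma I_half_coeff_last:
  assumes "d \<in> carrier (I_half_monoid k)" "diagram_coeff d i j \<noteq> 0"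
  shows "i k = j k"
proof -
  obtain B where B: "B \<in> d" "Top k \<in> B" "Bot k \<in> B" using assms(1) by (auto simp: I_half_iff)
  have "vertex_label i j (Top k) = vertex_label i j (Bot k)"
    using diagram_coeff_nonzeroD[OF assms(2) B] .
  then show ?thesis by simp
qed

lemma tphi_half_eq:
  assumes "n > 0"
  shows "tphi_half n k a = matrix_op (last_tuples n k) (diagram_matrix k a)"
  unfolding tphi_half_def half_power_eq_supported[OF assms] diagram_matrix_def
proof (rule restrict_linear_extension)
  fix d w j assume d: "d \<in> carrier (I_half_monoid k)" and w: "w \<in> supported (last_tuples n k)"
  show "diagram_action n (Suc k) d w j =
    (if j \<in> last_tuples n k then \<Sum>i\<in>last_tuples n k. w i * diagram_coeff d i j else 0)"
  proof (cases "j \<in> tuples n (Suc k)")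
    case True
    have "(\<Sum>i\<in>tuples n (Suc k). w i * diagram_coeff d i j) =
        (\<Sum>i\<in>last_tuples n k. w i * diagram_coeff d i j)"
      using w by (intro sum.mono_neutral_right finite_tuples) (auto simp: supported_def last_tuples_def)
    moreover have "(\<Sum>i\<in>last_tuples n k. w i * diagram_coeff d i j) = 0" if "j \<notin> last_tuples n k"
    proof (rule sum.neutral, rule ballI)
      fix i assume "i \<in> last_tuples n k"
      then have "i k \<noteq> j k" using that True by (auto simp: last_tuples_def)
      then show "w i * diagram_coeff d i j = 0" using I_half_coeff_last[OF d] by auto
    qed
    ultimately show ?thesis using True by (simp add: diagram_action_def)
  next
    case False
    then show ?thesis by (auto simp: diagram_action_def last_tuples_def)
  qed
qed

text \<open>Every block reaches both rows, so every label in one row occurs in the other one.\<close>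

lemma I_half_coeff_same_image:
  assumes d: "d \<in> carrier (I_half_monoid k)" and nz: "diagram_coeff d i j \<noteq> 0"
  shows "same_image (Suc k) i j"
proof -
  have p: "partition_on (vertices (Suc k)) d" and pr: "\<And>B. B \<in> d \<Longrightarrow> propagating B"
    using d by (auto simp: I_half_iff)
  have lab: "vertex_label i j u = vertex_label i j v" if "B \<in> d" "u \<in> B" "v \<in> B" for B u v
    using diagram_coeff_nonzeroD[OF nz that] .
  have blk: "\<exists>r<Suc k. \<exists>s<Suc k. vertex_label i j v = i r \<and> vertex_label i j v = j s"
    if v: "v \<in> vertices (Suc k)" for v
  proof -
    obtain B where B: "B \<in> d" "v \<in> B" using v partition_onD1[OF p] by auto
    then obtain r s where rs: "Top r \<in> B" "Bot s \<in> B"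
      using pr[OF B(1)] unfolding propagating_def by blast
    then have "Top r \<in> vertices (Suc k)" "Bot s \<in> vertices (Suc k)"
      using B partition_onD1[OF p] by auto
    moreover have "vertex_label i j v = i r" "vertex_label i j v = j s"
      using lab[OF B(1) B(2) rs(1)] lab[OF B(1) B(2) rs(2)] by auto
    ultimately show ?thesis using vertices_simps by blast
  qed
  show ?thesis
  proof (rule same_imageI)
    fix r assume "r < Suc k"
    then show "\<exists>s<Suc k. i r = j s" "\<exists>s<Suc k. j r = i s"
      using blk[of "Top r"] blk[of "Bot r"] by (auto simp: vertices_simps)
  qed
qed

definition refinement_sum :: "nat \<Rightarrow> (diagram \<Rightarrow> complex) \<Rightarrow> diagram \<Rightarrow> complex" where
  "refinement_sum k a e =
    (\<Sum>d\<in>{d \<in> carrier (I_half_monoid k). refines (vertices (Suc k)) d e}. a d)"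

lemma diagram_matrix_eq_refinement_sum:
  "diagram_matrix k a i j = refinement_sum k a (kernel_diagram (Suc k) i j)"
proof -
  have "diagram_matrix k a i j = (\<Sum>d\<in>carrier (I_half_monoid k).
      if refines (vertices (Suc k)) d (kernel_diagram (Suc k) i j) then a d else 0)"
    unfolding diagram_matrix_def
    by (intro sum.cong) (auto simp: I_half_iff diagram_coeff_eq_refines)
  then show ?thesis unfolding refinement_sum_def
    using finite_I_half by (simp add: sum.inter_filter)
qed

text \<open>The number of blocks is a rank function, as it drops strictly under proper coarsening.\<close>

lemma refinement_sum_surjective:
  obtains a where "\<And>e. e \<in> carrier (I_half_monoid k) \<Longrightarrow> refinement_sum k a e = b e"
    and "\<And>d. d \<notin> carrier (I_half_monoid k) \<Longrightarrow> a d = 0"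
proof -
  let ?P = "carrier (I_half_monoid k)" and ?V = "vertices (Suc k)"
  have "\<exists>a. \<forall>p\<in>?P. (\<Sum>q\<in>{q\<in>?P. refines ?V q p}. a q) = b p"
  proof (rule zeta_surjective[where r = card])
    show "refines ?V p p" if "p \<in> ?P" for p
      using that by (intro refines_refl) (simp add: I_half_iff)
    show "card p < card q" if "refines ?V q p" "p \<noteq> q" for p q
      using card_less_of_refines[OF finite_vertices that(1)] that(2) by simp
  qed (rule finite_I_half)
  then obtain a where a: "\<And>p. p \<in> ?P \<Longrightarrow> (\<Sum>q\<in>{q\<in>?P. refines ?V q p}. a q) = b p" by blast
  show ?thesis
  proof
    fix e assume e: "e \<in> ?P"
    have "refinement_sum k (\<lambda>d. if d \<in> ?P then a d else 0) e = (\<Sum>q\<in>{q\<in>?P. refines ?V q e}. a q)"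
      unfolding refinement_sum_def by (rule sum.cong) auto
    then show "refinement_sum k (\<lambda>d. if d \<in> ?P then a d else 0) e = b e" using a[OF e] by simp
  qed simp
qed

lemma partition_type_diagram_matrix: "partition_type (Suc k) (last_tuples n k) (diagram_matrix k a)"
proof -
  have "diagram_matrix k a i j = 0" if "\<not> same_image (Suc k) i j" for i j
    unfolding diagram_matrix_def using I_half_coeff_same_image that by (intro sum.neutral) auto
  moreover have "diagram_matrix k a i j = diagram_matrix k a i' j'"
    if "same_equalities (Suc k) i j i' j'" for i j i' j'
    using that by (simp add: diagram_matrix_eq_refinement_sum flip: kernel_diagram_eq_iff)
  ultimately show ?thesis unfolding partition_type_def by blast
qed

text \<open>Being constant on the fibres of \<open>kernel_diagram\<close>, the matrix comes from a function on diagrams, and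
  that function is the refinement sum of some coefficient function.\<close>

lemma partition_type_realized:
  assumes F: "partition_type (Suc k) (last_tuples n k) F"
  obtains a where "\<And>d. d \<notin> carrier (I_half_monoid k) \<Longrightarrow> a d = 0"
    and "\<And>i j. i \<in> last_tuples n k \<Longrightarrow> j \<in> last_tuples n k \<Longrightarrow> F i j = diagram_matrix k a i j"
proof -
  let ?T = "last_tuples n k" and ?m = "Suc k"
  have "\<exists>b. \<forall>p. (case p of (i, j) \<Rightarrow> i \<in> ?T \<and> j \<in> ?T \<and> same_image ?m i j) \<longrightarrow>
      (case p of (i, j) \<Rightarrow> F i j) = b (case p of (i, j) \<Rightarrow> kernel_diagram ?m i j)"
    unfolding function_factors_left_gen[symmetric]
    using F unfolding partition_type_def by (clarsimp split: prod.splits simp: kernel_diagram_eq_iff)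
  then obtain b where b: "\<And>i j. i \<in> ?T \<Longrightarrow> j \<in> ?T \<Longrightarrow> same_image ?m i j \<Longrightarrow>
      F i j = b (kernel_diagram ?m i j)"
    by auto
  obtain a where a: "\<And>e. e \<in> carrier (I_half_monoid k) \<Longrightarrow> refinement_sum k a e = b e"
    and supp: "\<And>d. d \<notin> carrier (I_half_monoid k) \<Longrightarrow> a d = 0"
    using refinement_sum_surjective[of k b] by metis
  have "F i j = diagram_matrix k a i j" if ij: "i \<in> ?T" "j \<in> ?T" for i j
  proof (cases "same_image ?m i j")
    case True
    then show ?thesis
      using a b[OF ij True] kernel_diagram_I_half[OF ij True] by (simp add: diagram_matrix_eq_refinement_sum)
  next
    case False
    then show ?thesis using F partition_type_diagram_matrix[of k n a] ij
      by (simp add: partition_type_def)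
  qed
  then show ?thesis using that supp by blast
qed

section \<open>The elements \<open>x_d\<close> and the kernel\<close>

text \<open>Each diagram \<open>d\<close> is by definition the sum of all \<open>x\<^sub>e\<close> with \<open>e\<close> coarser than \<open>d\<close>. Substituting this into
  the expansion of \<open>a\<close> in diagrams and exchanging the sums gives the coefficient of \<open>x\<^sub>e\<close>.\<close>

lemma x_basis_expansion:
  assumes "\<And>d. d \<notin> carrier (diagram_monoid m) \<Longrightarrow> a d = 0"
  shows "a f = (\<Sum>e\<in>carrier (diagram_monoid m).
    (\<Sum>d\<in>{d \<in> carrier (diagram_monoid m). refines (vertices m) d e}. a d) * x_basis m e f)"
proof -
  let ?A = "carrier (diagram_monoid m)" and ?V = "vertices m"
  have "is_x_basis m (x_basis m)" unfolding x_basis_def by (rule theI'[OF x_basis_ex1])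
  then have X: "of_bool (f = d) = (\<Sum>e\<in>{e \<in> ?A. refines ?V d e}. x_basis m e f)" if "d \<in> ?A" for d
  proof -
    have "(\<lambda>e. of_bool (e = d)) = (\<Sum>e\<in>{e \<in> ?A. refines ?V d e}. x_basis m e)"
      using \<open>is_x_basis m (x_basis m)\<close> that by (simp only: is_x_basis_def)
    from fun_cong[OF this, of f] show ?thesis by (simp only: sum_fun_apply)
  qed
  have "(\<Sum>e\<in>?A. (\<Sum>d\<in>{d \<in> ?A. refines ?V d e}. a d) * x_basis m e f) =
      (\<Sum>e\<in>?A. \<Sum>d\<in>?A. if refines ?V d e then a d * x_basis m e f else 0)"
    by (auto simp: sum.inter_filter finite_diagrams sum_distrib_right intro!: sum.cong)
  also have "\<dots> = (\<Sum>d\<in>?A. \<Sum>e\<in>?A. if refines ?V d e then a d * x_basis m e f else 0)"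
    by (rule sum.swap)
  also have "\<dots> = (\<Sum>d\<in>?A. a d * (\<Sum>e\<in>{e \<in> ?A. refines ?V d e}. x_basis m e f))"
    by (auto simp: sum.inter_filter finite_diagrams sum_distrib_left intro!: sum.cong)
  also have "\<dots> = (\<Sum>d\<in>?A. a d * of_bool (f = d))" using X by simp
  also have "\<dots> = (\<Sum>d\<in>?A. if d = f then a d else 0)" by (intro sum.cong) auto
  also have "\<dots> = a f" using assms finite_diagrams by simp
  finally show ?thesis by simp
qed

lemma x_basis_expansion_I_half:
  assumes supp: "\<And>d. d \<notin> carrier (I_half_monoid k) \<Longrightarrow> a d = 0"
  shows "a = (\<Sum>e\<in>carrier (I_half_monoid k). cscale (refinement_sum k a e) (x_basis (Suc k) e))"
proof
  fix f
  let ?A = "carrier (diagram_monoid (Suc k))" and ?P = "carrier (I_half_monoid k)"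
    and ?V = "vertices (Suc k)"
  have sub: "?P \<subseteq> ?A" by (auto simp: I_half_iff diagram_monoid_def)
  have rs: "(\<Sum>d\<in>{d \<in> ?A. refines ?V d e}. a d) = refinement_sum k a e" for e
    unfolding refinement_sum_def
    by (intro sum.mono_neutral_right) (use sub supp finite_diagrams in auto)
  have "refinement_sum k a e = 0" if "e \<notin> ?P" for e
    unfolding refinement_sum_def using that I_half_coarser by (intro sum.neutral) blast
  then have "(\<Sum>e\<in>?A. refinement_sum k a e * x_basis (Suc k) e f) =
      (\<Sum>e\<in>?P. refinement_sum k a e * x_basis (Suc k) e f)"
    by (intro sum.mono_neutral_right finite_diagrams sub) auto
  moreover have "a f = (\<Sum>e\<in>?A. refinement_sum k a e * x_basis (Suc k) e f)"
    using x_basis_expansion[of "Suc k" a f] supp sub rs by auto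
  ultimately show "a f = (\<Sum>e\<in>?P. cscale (refinement_sum k a e) (x_basis (Suc k) e)) f"
    by (simp add: sum_fun_apply cscale_def)
qed

text \<open>Choose \<open>a\<close> supported on \<open>I_{k+1/2}\<close> whose refinement sums form the indicator of \<open>c\<close>. Its expansion
  then has the single term \<open>x\<^sub>c\<close>, so \<open>x\<^sub>c = a\<close>.\<close>

lemma x_basis_dual:
  assumes c: "c \<in> carrier (I_half_monoid k)"
  shows "d \<notin> carrier (I_half_monoid k) \<Longrightarrow> x_basis (Suc k) c d = 0"
    and "e \<in> carrier (I_half_monoid k) \<Longrightarrow> refinement_sum k (x_basis (Suc k) c) e = of_bool (e = c)"
proof -
  let ?P = "carrier (I_half_monoid k)"
  obtain a where a: "\<And>e. e \<in> ?P \<Longrightarrow> refinement_sum k a e = of_bool (e = c)"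
    and supp: "\<And>d. d \<notin> ?P \<Longrightarrow> a d = 0"
    using refinement_sum_surjective[of k "\<lambda>e. of_bool (e = c)"] by metis
  have "a = (\<Sum>e\<in>?P. cscale (refinement_sum k a e) (x_basis (Suc k) e))"
    using x_basis_expansion_I_half supp by blast
  also have "\<dots> = (\<Sum>e\<in>?P. if e = c then x_basis (Suc k) c else 0)"
    using a by (intro sum.cong) (auto simp: cscale_def fun_eq_iff)
  also have "\<dots> = x_basis (Suc k) c" using c finite_I_half by simp
  finally have "a = x_basis (Suc k) c" .
  then show "d \<notin> ?P \<Longrightarrow> x_basis (Suc k) c d = 0"
    "e \<in> ?P \<Longrightarrow> refinement_sum k (x_basis (Suc k) c) e = of_bool (e = c)"
    using a supp by auto
qed

lemma diagram_matrix_eq_0_iff: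
  assumes "n > 0"
  shows "(\<forall>i\<in>last_tuples n k. \<forall>j\<in>last_tuples n k. diagram_matrix k a i j = 0) \<longleftrightarrow>
    (\<forall>e\<in>carrier (I_half_monoid k). card e \<le> n \<longrightarrow> refinement_sum k a e = 0)" (is "?L \<longleftrightarrow> ?R")
proof
  assume L: ?L
  show ?R
  proof (intro ballI impI)
    fix e assume "e \<in> carrier (I_half_monoid k)" "card e \<le> n"
    then obtain i j where "i \<in> last_tuples n k" "j \<in> last_tuples n k" "kernel_diagram (Suc k) i j = e"
      using kernel_diagram_surj[OF assms] by metis
    then show "refinement_sum k a e = 0" using L diagram_matrix_eq_refinement_sum by metis
  qed
next
  assume R: ?R
  show ?L
  proof (intro ballI)
    fix i j assume ij: "i \<in> last_tuples n k" "j \<in> last_tuples n k"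
    show "diagram_matrix k a i j = 0"
    proof (cases "same_image (Suc k) i j")
      case True
      then show ?thesis using R kernel_diagram_I_half[OF ij True] card_kernel_diagram[OF ij]
        by (simp add: diagram_matrix_eq_refinement_sum)
    next
      case False
      then show ?thesis using partition_type_diagram_matrix[of k n a] ij
        by (simp add: partition_type_def)
    qed
  qed
qed

lemma diagram_matrix_kernel:
  assumes "n > 0"
  shows "{a. (\<forall>d. d \<notin> carrier (I_half_monoid k) \<longrightarrow> a d = 0) \<and>
      (\<forall>e\<in>carrier (I_half_monoid k). card e \<le> n \<longrightarrow> refinement_sum k a e = 0)} =
    cspan (x_basis (Suc k) ` {d \<in> carrier (I_half_monoid k). card d > n})" (is "?K = cspan ?X")
proof (intro equalityI subsetI)
  fix a assume a: "a \<in> ?K"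
  have "(\<Sum>e\<in>carrier (I_half_monoid k). cscale (refinement_sum k a e) (x_basis (Suc k) e)) \<in> cspan ?X"
  proof (rule cfun.span_sum)
    fix e assume e: "e \<in> carrier (I_half_monoid k)"
    show "cscale (refinement_sum k a e) (x_basis (Suc k) e) \<in> cspan ?X"
    proof (cases "card e > n")
      case True
      then show ?thesis using e by (intro cfun.span_scale cfun.span_base) auto
    next
      case False
      then show ?thesis using a e by (simp add: cfun.span_zero)
    qed
  qed
  moreover have "a = (\<Sum>e\<in>carrier (I_half_monoid k).
      cscale (refinement_sum k a e) (x_basis (Suc k) e))"
    by (rule x_basis_expansion_I_half) (use a in blast)
  ultimately show "a \<in> cspan ?X" by simp
next
  have "?X \<subseteq> ?K" using x_basis_dual by auto
  moreover have "cfun.subspace ?K"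
    by (rule cfun.subspaceI)
      (auto simp: refinement_sum_def cscale_def sum.distrib simp flip: sum_distrib_left)
  ultimately have "cspan ?X \<subseteq> ?K" by (rule cfun.span_minimal)
  then show "a \<in> ?K" if "a \<in> cspan ?X" for a using that by blast
qed

section \<open>The operators of rook matrices\<close>

text \<open>The order of the coordinates is exchanged so that \<open>(s, t)\<close> means that the matrix sends \<open>e_s\<close> to
  \<open>e_t\<close>.\<close>

definition entries :: "nat \<Rightarrow> complex mat \<Rightarrow> (nat \<times> nat) set" where
  "entries n A = {(s, t). s < n \<and> t < n \<and> A $$ (t, s) \<noteq> 0}"

definition partial_bijections :: "nat \<Rightarrow> (nat \<times> nat) set set" where
  "partial_bijections n = {S. S \<subseteq> {..<n} \<times> {..<n} \<and>
    (\<forall>(s, t)\<in>S. \<forall>(s', t')\<in>S. s = s' \<longleftrightarrow> t = t') \<and> (n - 1, n - 1) \<in> S}"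

lemma rook_submonoid_iff:
  "A \<in> carrier (rook_submonoid n) \<longleftrightarrow> A \<in> carrier_mat n n \<and>
    (\<forall>i<n. \<forall>j<n. A $$ (i, j) \<in> {0, 1}) \<and>
    (\<forall>i<n. card {j. j < n \<and> A $$ (i, j) \<noteq> 0} \<le> 1) \<and>
    (\<forall>j<n. card {i. i < n \<and> A $$ (i, j) \<noteq> 0} \<le> 1) \<and> A $$ (n - 1, n - 1) = 1"
  by (auto simp: rook_submonoid_def rook_monoid_def)

lemma rook_entry:
  assumes "A \<in> carrier (rook_submonoid n)" "s < n" "t < n"
  shows "A $$ (t, s) = of_bool ((s, t) \<in> entries n A)"
  using assms by (auto simp: rook_submonoid_iff entries_def)

lemma inj_on_entries: "inj_on (entries n) (carrier (rook_submonoid n))"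
proof (rule inj_onI)
  fix A B assume A: "A \<in> carrier (rook_submonoid n)" and B: "B \<in> carrier (rook_submonoid n)"
    and eq: "entries n A = entries n B"
  show "A = B"
  proof (rule eq_matI)
    fix t s assume "t < dim_row B" "s < dim_col B"
    then have "t < n" "s < n" using B by (auto simp: rook_submonoid_iff)
    then show "A $$ (t, s) = B $$ (t, s)" using rook_entry[OF A] rook_entry[OF B] eq by simp
  qed (use A B in \<open>auto simp: rook_submonoid_iff\<close>)
qed

text \<open>The bounds on the rows and columns make the relation injective and single-valued.\<close>

lemma entries_partial_bijection:
  assumes "n > 0" and A: "A \<in> carrier (rook_submonoid n)"
  shows "entries n A \<in> partial_bijections n"
proof -
  have "t = t'" if "(s, t) \<in> entries n A" "(s, t') \<in> entries n A" for s t t'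
  proof -
    have "card {i. i < n \<and> A $$ (i, s) \<noteq> 0} \<le> Suc 0"
      using A that by (auto simp: rook_submonoid_iff entries_def)
    then show ?thesis using that by (auto simp: card_le_Suc0_iff_eq entries_def)
  qed
  moreover have "s = s'" if "(s, t) \<in> entries n A" "(s', t) \<in> entries n A" for s s' t
  proof -
    have "card {j. j < n \<and> A $$ (t, j) \<noteq> 0} \<le> Suc 0"
      using A that by (auto simp: rook_submonoid_iff entries_def)
    then show ?thesis using that by (auto simp: card_le_Suc0_iff_eq entries_def)
  qed
  moreover have "(n - 1, n - 1) \<in> entries n A"
    using A assms(1) by (auto simp: entries_def rook_submonoid_iff)
  moreover have "entries n A \<subseteq> {..<n} \<times> {..<n}" by (auto simp: entries_def)
  ultimately show ?thesis unfolding partial_bijections_def by blast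
qed

lemma entries_surj:
  assumes S: "S \<in> partial_bijections n"
  obtains A where "A \<in> carrier (rook_submonoid n)" "entries n A = S"
proof
  define A :: "complex mat" where "A = mat n n (\<lambda>(t, s). of_bool ((s, t) \<in> S))"
  have sub: "S \<subseteq> {..<n} \<times> {..<n}" and last: "(n - 1, n - 1) \<in> S"
    and bij: "\<And>s t t'. (s, t) \<in> S \<Longrightarrow> (s, t') \<in> S \<Longrightarrow> t = t'"
      "\<And>s s' t. (s, t) \<in> S \<Longrightarrow> (s', t) \<in> S \<Longrightarrow> s = s'"
    using S unfolding partial_bijections_def by blast+
  have Ats: "A $$ (t, s) = of_bool ((s, t) \<in> S)" if "t < n" "s < n" for t s
    using that by (simp add: A_def)
  show "entries n A = S" using sub Ats by (auto simp: entries_def)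
  have "card {j. j < n \<and> A $$ (i, j) \<noteq> 0} \<le> Suc 0" if "i < n" for i
    using that Ats bij(2) by (auto simp: card_le_Suc0_iff_eq)
  moreover have "card {i. i < n \<and> A $$ (i, j) \<noteq> 0} \<le> Suc 0" if "j < n" for j
    using that Ats bij(1) by (auto simp: card_le_Suc0_iff_eq)
  moreover have "A $$ (n - 1, n - 1) = 1" using Ats last sub by auto
  ultimately show "A \<in> carrier (rook_submonoid n)"
    using Ats by (simp add: rook_submonoid_iff) (simp add: A_def)
qed

lemma finite_rook: "n > 0 \<Longrightarrow> finite (carrier (rook_submonoid n))"
proof (rule finite_imageD[OF _ inj_on_entries])
  show "finite (entries n ` carrier (rook_submonoid n))"
    by (rule finite_subset[of _ "Pow ({..<n} \<times> {..<n})"]) (auto simp: entries_def)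
qed

definition rook_matrix ::
  "nat \<Rightarrow> nat \<Rightarrow> (complex mat \<Rightarrow> complex) \<Rightarrow> (nat \<Rightarrow> nat) \<Rightarrow> (nat \<Rightarrow> nat) \<Rightarrow> complex" where
  "rook_matrix n k a i j = (\<Sum>A\<in>carrier (rook_submonoid n). a A * (\<Prod>r<Suc k. A $$ (j r, i r)))"

lemma rook_prod:
  assumes "A \<in> carrier (rook_submonoid n)" "i \<in> tuples n m" "j \<in> tuples n m"
  shows "(\<Prod>r<m. A $$ (j r, i r)) = of_bool (pairs m i j \<subseteq> entries n A)"
proof -
  have "i r < n" "j r < n" if "r < m" for r
    using that assms(2,3) by (auto simp: tuples_def PiE_iff)
  then have "(\<Prod>r<m. A $$ (j r, i r)) = (\<Prod>r<m. of_bool ((i r, j r) \<in> entries n A))"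
    using rook_entry[OF assms(1)] by (intro prod.cong) auto
  also have "\<dots> = of_bool (\<forall>r<m. (i r, j r) \<in> entries n A)"
    by (auto simp: prod_zero_iff)
  also have "(\<forall>r<m. (i r, j r) \<in> entries n A) \<longleftrightarrow> pairs m i j \<subseteq> entries n A"
    by (auto simp: pairs_def)
  finally show ?thesis .
qed

text \<open>A matrix in \<open>R_{n-1}\<close> fixes \<open>n - 1\<close>, so it keeps the last entry of a tuple.\<close>

lemma rook_prod_last:
  assumes "n > 0" and A: "A \<in> carrier (rook_submonoid n)"
    and i: "i \<in> last_tuples n k" and j: "j \<in> tuples n (Suc k)"
    and sub: "pairs (Suc k) i j \<subseteq> entries n A"
  shows "j \<in> last_tuples n k"
proof -
  have "(n - 1, j k) \<in> entries n A"
    using sub last_tuplesD(2)[OF i] by (auto simp: pairs_def)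
  then have "j k = n - 1"
    using entries_partial_bijection[OF assms(1) A] by (fastforce simp: partial_bijections_def)
  then show ?thesis using j by (simp add: last_tuples_def)
qed

lemma tpsi_half_eq:
  assumes "n > 0"
  shows "tpsi_half n k a = matrix_op (last_tuples n k) (rook_matrix n k a)"
  unfolding tpsi_half_def half_power_eq_supported[OF assms] rook_matrix_def
proof (rule restrict_linear_extension)
  fix A w j assume A: "A \<in> carrier (rook_submonoid n)" and w: "w \<in> supported (last_tuples n k)"
  show "mat_action n (Suc k) A w j = (if j \<in> last_tuples n k
    then \<Sum>i\<in>last_tuples n k. w i * (\<Prod>r<Suc k. A $$ (j r, i r)) else 0)"
  proof (cases "j \<in> tuples n (Suc k)")
    case True
    have "(\<Sum>i\<in>tuples n (Suc k). (\<Prod>r<Suc k. A $$ (j r, i r)) * w i) =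
        (\<Sum>i\<in>last_tuples n k. (\<Prod>r<Suc k. A $$ (j r, i r)) * w i)"
      using w by (intro sum.mono_neutral_right finite_tuples) (auto simp: supported_def last_tuples_def)
    also have "\<dots> = (\<Sum>i\<in>last_tuples n k. w i * (\<Prod>r<Suc k. A $$ (j r, i r)))"
      by (simp add: mult.commute)
    finally have "mat_action n (Suc k) A w j =
        (\<Sum>i\<in>last_tuples n k. w i * (\<Prod>r<Suc k. A $$ (j r, i r)))"
      using True by (simp add: mat_action_def)
    moreover have "(\<Sum>i\<in>last_tuples n k. w i * (\<Prod>r<Suc k. A $$ (j r, i r))) = 0"
      if "j \<notin> last_tuples n k"
    proof (rule sum.neutral, rule ballI)
      fix i assume i: "i \<in> last_tuples n k"
      then have "\<not> pairs (Suc k) i j \<subseteq> entries n A"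
        using rook_prod_last[OF assms A i True] that by blast
      then have "(\<Prod>r<Suc k. A $$ (j r, i r)) = 0"
        using rook_prod[OF A last_tuplesD(1)[OF i] True] by simp
      then show "w i * (\<Prod>r<Suc k. A $$ (j r, i r)) = 0" by (simp only: mult_zero_right)
    qed
    ultimately show ?thesis by presburger
  next
    case False
    then show ?thesis by (auto simp: mat_action_def last_tuples_def)
  qed
qed

definition extension_sum :: "nat \<Rightarrow> (complex mat \<Rightarrow> complex) \<Rightarrow> (nat \<times> nat) set \<Rightarrow> complex" where
  "extension_sum n a S = (\<Sum>A\<in>{A \<in> carrier (rook_submonoid n). S \<subseteq> entries n A}. a A)"

lemma rook_matrix_eq_extension_sum:
  assumes "n > 0" "i \<in> last_tuples n k" "j \<in> last_tuples n k"
  shows "rook_matrix n k a i j = extension_sum n a (pairs (Suc k) i j)"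
proof -
  have "rook_matrix n k a i j = (\<Sum>A\<in>carrier (rook_submonoid n).
      if pairs (Suc k) i j \<subseteq> entries n A then a A else 0)"
    unfolding rook_matrix_def
  proof (rule sum.cong[OF refl])
    fix A assume "A \<in> carrier (rook_submonoid n)"
    from rook_prod[OF this last_tuplesD(1)[OF assms(2)] last_tuplesD(1)[OF assms(3)]]
    show "a A * (\<Prod>r<Suc k. A $$ (j r, i r)) =
        (if pairs (Suc k) i j \<subseteq> entries n A then a A else 0)" by auto
  qed
  then show ?thesis unfolding extension_sum_def
    using finite_rook[OF assms(1)] by (simp add: sum.inter_filter)
qed

text \<open>Containment of partial bijections is ranked by their size. The sums are indexed by the matrices
  themselves, which correspond bijectively to the partial bijections fixing \<open>n - 1\<close>.\<close>

lemma extension_sum_surjective: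
  assumes "n > 0"
  obtains a where "\<And>S. S \<in> partial_bijections n \<Longrightarrow> extension_sum n a S = b S"
    and "\<And>A. A \<notin> carrier (rook_submonoid n) \<Longrightarrow> a A = 0"
proof -
  let ?P = "carrier (rook_submonoid n)"
  have "\<exists>a. \<forall>A\<in>?P. (\<Sum>B\<in>{B\<in>?P. entries n A \<subseteq> entries n B}. a B) = b (entries n A)"
  proof (rule zeta_surjective[where r = "\<lambda>A. card (entries n A)"])
    fix A B assume AB: "A \<in> ?P" "B \<in> ?P" "entries n A \<subseteq> entries n B" "A \<noteq> B"
    then have "entries n A \<subset> entries n B" using inj_onD[OF inj_on_entries] by blast
    moreover have "finite (entries n B)"
      by (rule finite_subset[of _ "{..<n} \<times> {..<n}"]) (auto simp: entries_def)
    ultimately show "card (entries n A) < card (entries n B)" by (rule psubset_card_mono[rotated])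
  qed (use finite_rook[OF assms] in auto)
  then obtain a where a: "\<And>A. A \<in> ?P \<Longrightarrow>
      (\<Sum>B\<in>{B\<in>?P. entries n A \<subseteq> entries n B}. a B) = b (entries n A)" by blast
  show ?thesis
  proof
    fix S assume "S \<in> partial_bijections n"
    then obtain A where A: "A \<in> ?P" "entries n A = S" using entries_surj by blast
    have "extension_sum n (\<lambda>A. if A \<in> ?P then a A else 0) S = (\<Sum>B\<in>{B\<in>?P. S \<subseteq> entries n B}. a B)"
      unfolding extension_sum_def by (rule sum.cong) auto
    then show "extension_sum n (\<lambda>A. if A \<in> ?P then a A else 0) S = b S" using a[OF A(1)] A(2) by simp
  qed simp
qed

lemma bijection_type_rook_matrix:
  assumes "n > 0"
  shows "bijection_type (Suc k) (last_tuples n k) (rook_matrix n k a)"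
proof -
  have "rook_matrix n k a i j = 0"
    if ij: "i \<in> last_tuples n k" "j \<in> last_tuples n k" and nk: "\<not> same_kernel (Suc k) i j" for i j
  proof -
    have "\<not> pairs (Suc k) i j \<subseteq> entries n A" if A: "A \<in> carrier (rook_submonoid n)" for A
    proof
      assume sub: "pairs (Suc k) i j \<subseteq> entries n A"
      have "(i r, j r) \<in> entries n A" if "r < Suc k" for r using sub that by (auto simp: pairs_def)
      moreover have "s = s' \<longleftrightarrow> t = t'" if "(s, t) \<in> entries n A" "(s', t') \<in> entries n A" for s t s' t'
        using entries_partial_bijection[OF assms A] that unfolding partial_bijections_def by blast
      ultimately have "same_kernel (Suc k) i j" by (simp add: same_kernel_def)
      then show False using nk by simp
    qed
    then show ?thesis
      unfolding rook_matrix_eq_extension_sum[OF assms ij] extension_sum_def by (intro sum.neutral) auto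
  qed
  then show ?thesis
    unfolding bijection_type_def using rook_matrix_eq_extension_sum[OF assms] by (metis (no_types))
qed

lemma pairs_partial_bijection:
  assumes "i \<in> last_tuples n k" "j \<in> last_tuples n k" "same_kernel (Suc k) i j"
  shows "pairs (Suc k) i j \<in> partial_bijections n"
proof -
  have "(n - 1, n - 1) \<in> pairs (Suc k) i j"
    using last_tuplesD(2)[OF assms(1)] last_tuplesD(2)[OF assms(2)] by (force simp: pairs_def)
  moreover have "pairs (Suc k) i j \<subseteq> {..<n} \<times> {..<n}"
    using last_tuplesD(3)[OF assms(1)] last_tuplesD(3)[OF assms(2)] by (auto simp: pairs_def)
  moreover have "\<forall>(s, t)\<in>pairs (Suc k) i j. \<forall>(s', t')\<in>pairs (Suc k) i j. s = s' \<longleftrightarrow> t = t'"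
    using assms(3) by (auto simp: pairs_def same_kernel_def)
  ultimately show ?thesis by (simp add: partial_bijections_def)
qed

text \<open>The analogue of \<open>partition_type_realized\<close>, with \<open>pairs\<close> in place of \<open>kernel_diagram\<close>.\<close>

lemma bijection_type_realized:
  assumes n: "n > 0" and G: "bijection_type (Suc k) (last_tuples n k) G"
  obtains a where "\<And>A. A \<notin> carrier (rook_submonoid n) \<Longrightarrow> a A = 0"
    and "\<And>i j. i \<in> last_tuples n k \<Longrightarrow> j \<in> last_tuples n k \<Longrightarrow> G i j = rook_matrix n k a i j"
proof -
  let ?T = "last_tuples n k" and ?m = "Suc k"
  have "\<exists>b. \<forall>p. (case p of (i, j) \<Rightarrow> i \<in> ?T \<and> j \<in> ?T \<and> same_kernel ?m i j) \<longrightarrow>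
      (case p of (i, j) \<Rightarrow> G i j) = b (case p of (i, j) \<Rightarrow> pairs ?m i j)"
    unfolding function_factors_left_gen[symmetric]
    using G unfolding bijection_type_def by (clarsimp split: prod.splits)
  then obtain b where b: "\<And>i j. i \<in> ?T \<Longrightarrow> j \<in> ?T \<Longrightarrow> same_kernel ?m i j \<Longrightarrow> G i j = b (pairs ?m i j)"
    by auto
  obtain a where a: "\<And>S. S \<in> partial_bijections n \<Longrightarrow> extension_sum n a S = b S"
    and supp: "\<And>A. A \<notin> carrier (rook_submonoid n) \<Longrightarrow> a A = 0"
    using extension_sum_surjective[OF n, of b] by metis
  have "G i j = rook_matrix n k a i j" if ij: "i \<in> ?T" "j \<in> ?T" for i j
  proof (cases "same_kernel ?m i j")
    case True
    then show ?thesis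
      using a b[OF ij True] pairs_partial_bijection[OF ij True] by (simp add: rook_matrix_eq_extension_sum[OF n ij])
  next
    case False
    then show ?thesis using G bijection_type_rook_matrix[OF n, of k a] ij
      by (simp add: bijection_type_def)
  qed
  then show ?thesis using that supp by blast
qed

section \<open>Composition of diagrams\<close>

text \<open>Two vertices are adjacent in the stacked graph if they lie in a common block of one of the two
  diagrams. The components are the classes of the reflexive transitive closure.\<close>

definition stack_rel :: "diagram \<Rightarrow> diagram \<Rightarrow> (vertex \<times> vertex) set" where
  "stack_rel d1 d2 = (\<Union>B\<in>stack d1 d2. B \<times> B)"

lemma stack_rel_sym: "(u, v) \<in> (stack_rel d1 d2)\<^sup>* \<Longrightarrow> (v, u) \<in> (stack_rel d1 d2)\<^sup>*"
proof -
  have "sym (stack_rel d1 d2)" by (auto simp: stack_rel_def sym_def)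
  then show "(u, v) \<in> (stack_rel d1 d2)\<^sup>* \<Longrightarrow> (v, u) \<in> (stack_rel d1 d2)\<^sup>*"
    using sym_rtrancl symD by metis
qed

lemma stack_rel_upper: "B \<in> d1 \<Longrightarrow> u \<in> B \<Longrightarrow> v \<in> B \<Longrightarrow> (to_upper u, to_upper v) \<in> (stack_rel d1 d2)\<^sup>*"
  by (rule r_into_rtrancl) (auto simp: stack_rel_def stack_def)

lemma stack_rel_lower: "B \<in> d2 \<Longrightarrow> u \<in> B \<Longrightarrow> v \<in> B \<Longrightarrow> (to_lower u, to_lower v) \<in> (stack_rel d1 d2)\<^sup>*"
  by (rule r_into_rtrancl) (auto simp: stack_rel_def stack_def)

lemma block_in_I_half:
  assumes "d \<in> carrier (I_half_monoid k)" "v \<in> vertices (Suc k)"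
  obtains B r s where "B \<in> d" "v \<in> B" "Top r \<in> B" "Bot s \<in> B" "r < Suc k" "s < Suc k"
proof -
  have p: "partition_on (vertices (Suc k)) d" using assms(1) by (simp add: I_half_iff)
  then obtain B where B: "B \<in> d" "v \<in> B" using partition_onD1 assms(2) by blast
  then have "propagating B" using assms(1) by (simp add: I_half_iff)
  then obtain r s where rs: "Top r \<in> B" "Bot s \<in> B" unfolding propagating_def by blast
  then have "Top r \<in> vertices (Suc k)" "Bot s \<in> vertices (Suc k)" using p B partition_onD1 by blast+
  then show ?thesis using that B rs vertices_simps by blast
qed

text \<open>The labelling of all three rows of the stacked graph, with the labels \<open>l\<close> in the middle.\<close>

fun stack_label :: "(nat \<Rightarrow> nat) \<Rightarrow> (nat \<Rightarrow> nat) \<Rightarrow> (nat \<Rightarrow> nat) \<Rightarrow> vertex \<Rightarrow> nat" where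
  "stack_label i l j (Top r) = i r"
| "stack_label i l j (Mid r) = l r"
| "stack_label i l j (Bot r) = j r"

lemma stack_label_vertex_label: "v \<in> vertices m \<Longrightarrow> stack_label i l j v = vertex_label i j v"
  by (elim vertices_cases) auto

context
  fixes k :: nat and d1 d2 :: diagram
  assumes d1: "d1 \<in> carrier (I_half_monoid k)" and d2: "d2 \<in> carrier (I_half_monoid k)"
begin

abbreviation "linked \<equiv> (stack_rel d1 d2)\<^sup>*"

lemma stack_vertices: "\<Union>(stack d1 d2) = vertices (Suc k) \<union> Mid ` {..<Suc k}"
proof -
  have "\<Union>d1 = vertices (Suc k)" "\<Union>d2 = vertices (Suc k)"
    using d1 d2 partition_onD1 by (auto simp: I_half_iff)
  then have "\<Union>(stack d1 d2) = to_upper ` vertices (Suc k) \<union> to_lower ` vertices (Suc k)"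
    by (simp add: stack_def flip: image_Union)
  then show ?thesis by (simp add: vertices_def image_Un image_image) blast
qed

lemma linked_closed:
  assumes "(u, v) \<in> linked" "u \<in> \<Union>(stack d1 d2)"
  shows "v \<in> \<Union>(stack d1 d2)"
  using assms by (induction rule: rtrancl_induct) (auto simp: stack_rel_def)

lemma Mid_linked:
  assumes "r < Suc k"
  shows "\<exists>s<Suc k. (Mid r, Top s) \<in> linked" "\<exists>s<Suc k. (Mid r, Bot s) \<in> linked"
proof -
  obtain B s where "B \<in> d1" "Bot r \<in> B" "Top s \<in> B" "s < Suc k"
    using block_in_I_half[OF d1, of "Bot r"] assms by (metis vertices_simps(2))
  then show "\<exists>s<Suc k. (Mid r, Top s) \<in> linked" using stack_rel_upper[of B d1 "Bot r" "Top s"] by auto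
  obtain B s where "B \<in> d2" "Top r \<in> B" "Bot s \<in> B" "s < Suc k"
    using block_in_I_half[OF d2, of "Top r"] assms by (metis vertices_simps(1))
  then show "\<exists>s<Suc k. (Mid r, Bot s) \<in> linked" using stack_rel_lower[of B d2 "Top r" "Bot s"] by auto
qed

text \<open>Since all blocks are propagating, every block of either diagram reaches the middle row, and from
  there both outer rows. So no component is lost when the middle row is discarded.\<close>

lemma linked_Mid:
  assumes "v \<in> \<Union>(stack d1 d2)"
  obtains r where "r < Suc k" "(v, Mid r) \<in> linked"
proof -
  consider r where "r < Suc k" "v = Top r" | r where "r < Suc k" "v = Bot r"
    | r where "r < Suc k" "v = Mid r"
    using assms unfolding stack_vertices by (auto elim: vertices_cases)
  then show ?thesis
  proof cases
    case (1 r)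
    then obtain B s where "B \<in> d1" "Top r \<in> B" "Bot s \<in> B" "s < Suc k"
      using block_in_I_half[OF d1, of "Top r"] by (metis vertices_simps(1))
    then show ?thesis using that stack_rel_upper[of B d1 "Top r" "Bot s"] 1 by auto
  next
    case (2 r)
    then obtain B s where "B \<in> d2" "Bot r \<in> B" "Top s \<in> B" "s < Suc k"
      using block_in_I_half[OF d2, of "Bot r"] by (metis vertices_simps(2))
    then show ?thesis using that stack_rel_lower[of B d2 "Bot r" "Top s"] 2 by auto
  qed (use that in auto)
qed

lemma linked_Top_Bot:
  assumes "v \<in> \<Union>(stack d1 d2)"
  shows "\<exists>s<Suc k. (v, Top s) \<in> linked" "\<exists>s<Suc k. (v, Bot s) \<in> linked"
proof -
  obtain r where r: "r < Suc k" "(v, Mid r) \<in> linked" using linked_Mid[OF assms] by blast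
  show "\<exists>s<Suc k. (v, Top s) \<in> linked" using Mid_linked(1)[OF r(1)] rtrancl_trans[OF r(2)] by blast
  show "\<exists>s<Suc k. (v, Bot s) \<in> linked" using Mid_linked(2)[OF r(1)] rtrancl_trans[OF r(2)] by blast
qed

lemma linked_last: "(Top k, Mid k) \<in> linked" "(Mid k, Bot k) \<in> linked"
proof -
  show "(Top k, Mid k) \<in> linked"
    using d1 stack_rel_upper[of _ d1 "Top k" "Bot k"] unfolding I_half_iff to_upper.simps by blast
  show "(Mid k, Bot k) \<in> linked"
    using d2 stack_rel_lower[of _ d2 "Top k" "Bot k"] unfolding I_half_iff to_lower.simps by blast
qed

text \<open>Every component can be represented by a vertex of an outer row.\<close>

lemma diagram_comp_eq:
  "diagram_comp d1 d2 = (\<lambda>v. {u \<in> vertices (Suc k). (v, u) \<in> linked}) ` vertices (Suc k)"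
    (is "_ = ?c ` ?V")
proof -
  have minus: "linked `` {v} - range Mid = ?c v" if v: "v \<in> \<Union>(stack d1 d2)" for v
  proof (intro equalityI subsetI)
    fix u assume u: "u \<in> linked `` {v} - range Mid"
    then have "u \<in> \<Union>(stack d1 d2)" using linked_closed v by blast
    then show "u \<in> ?c v" using u unfolding stack_vertices by auto
  qed (auto simp: vertices_def)
  have "diagram_comp d1 d2 = ?c ` \<Union>(stack d1 d2) - {{}}"
  proof -
    have "\<Union>(stack d1 d2) // linked = (\<lambda>v. linked `` {v}) ` \<Union>(stack d1 d2)"
      by (auto simp: quotient_def)
    then have "(\<lambda>C. C - range Mid) ` (\<Union>(stack d1 d2) // linked) = ?c ` \<Union>(stack d1 d2)"
      using minus by (simp only: image_image cong: image_cong)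
    then show ?thesis by (simp only: diagram_comp_def stack_rel_def)
  qed
  also have "\<dots> = ?c ` ?V"
  proof (intro equalityI subsetI)
    fix C assume "C \<in> ?c ` \<Union>(stack d1 d2) - {{}}"
    then obtain v u where "C = ?c v" "u \<in> ?V" "(v, u) \<in> linked" by blast
    then have "C = ?c u" by (auto intro: rtrancl_trans stack_rel_sym)
    then show "C \<in> ?c ` ?V" using \<open>u \<in> ?V\<close> by blast
  next
    fix C assume "C \<in> ?c ` ?V"
    then obtain v where v: "v \<in> ?V" "C = ?c v" by blast
    then have "v \<in> C" by simp
    then show "C \<in> ?c ` \<Union>(stack d1 d2) - {{}}" using v unfolding stack_vertices by blast
  qed
  finally show ?thesis .
qed

lemma diagram_comp_I_half: "diagram_comp d1 d2 \<in> carrier (I_half_monoid k)"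
proof -
  let ?V = "vertices (Suc k)"
  have sub: "?V \<subseteq> \<Union>(stack d1 d2)" unfolding stack_vertices by blast
  have "partition_on ?V (diagram_comp d1 d2)"
  proof (rule partition_onI)
    show "\<Union>(diagram_comp d1 d2) = ?V" unfolding diagram_comp_eq by auto
    show "{} \<notin> diagram_comp d1 d2" unfolding diagram_comp_eq by blast
    fix p q assume pq: "p \<in> diagram_comp d1 d2" "q \<in> diagram_comp d1 d2" "p \<noteq> q"
    then obtain v v' where v: "p = {u \<in> ?V. (v, u) \<in> linked}" "q = {u \<in> ?V. (v', u) \<in> linked}"
      unfolding diagram_comp_eq by blast
    show "disjnt p q"
    proof (rule ccontr)
      assume "\<not> disjnt p q"
      then obtain w where "(v, w) \<in> linked" "(v', w) \<in> linked" unfolding v disjnt_def by blast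
      then have "(v, v') \<in> linked" "(v', v) \<in> linked" by (meson rtrancl_trans stack_rel_sym)+
      then have "(v, u) \<in> linked \<longleftrightarrow> (v', u) \<in> linked" for u by (meson rtrancl_trans)
      then have "p = q" unfolding v by blast
      then show False using pq(3) by simp
    qed
  qed
  moreover have "propagating B" if B: "B \<in> diagram_comp d1 d2" for B
  proof -
    obtain v where v: "v \<in> ?V" "B = {u \<in> ?V. (v, u) \<in> linked}"
      using B unfolding diagram_comp_eq by blast
    obtain r s where "r < Suc k" "(v, Top r) \<in> linked" "s < Suc k" "(v, Bot s) \<in> linked"
      using linked_Top_Bot[of v] v(1) sub by blast
    then have "Top r \<in> B" "Bot s \<in> B" unfolding v(2) by (simp_all add: vertices_simps)
    then show ?thesis unfolding propagating_def by blast
  qed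
  moreover have "\<exists>B\<in>diagram_comp d1 d2. Top k \<in> B \<and> Bot k \<in> B"
  proof
    show "{u \<in> ?V. (Top k, u) \<in> linked} \<in> diagram_comp d1 d2"
      unfolding diagram_comp_eq by (intro imageI) (simp add: vertices_simps)
    show "Top k \<in> {u \<in> ?V. (Top k, u) \<in> linked} \<and> Bot k \<in> {u \<in> ?V. (Top k, u) \<in> linked}"
      using rtrancl_trans[OF linked_last] by (simp add: vertices_simps)
  qed
  ultimately show ?thesis by (simp add: I_half_iff)
qed

text \<open>A labelling is constant on the blocks of both diagrams if and only if it is constant on the
  components of the stacked graph.\<close>

lemma diagram_coeff_mult:
  "diagram_coeff d1 i l * diagram_coeff d2 l j =
    of_bool (\<forall>(u, v)\<in>linked. stack_label i l j u = stack_label i l j v)"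
proof -
  have up: "vertex_label i l u = stack_label i l j (to_upper u)" if "u \<in> B" "B \<in> d1" for u B
  proof -
    have "u \<in> vertices (Suc k)" using that d1 partition_onD1 by (auto simp: I_half_iff)
    then show ?thesis by (elim vertices_cases) auto
  qed
  have low: "vertex_label l j u = stack_label i l j (to_lower u)" if "u \<in> B" "B \<in> d2" for u B
  proof -
    have "u \<in> vertices (Suc k)" using that d2 partition_onD1 by (auto simp: I_half_iff)
    then show ?thesis by (elim vertices_cases) auto
  qed
  have up': "(\<forall>B\<in>d1. \<forall>u\<in>B. \<forall>v\<in>B. vertex_label i l u = vertex_label i l v) \<longleftrightarrow>
      (\<forall>B\<in>d1. \<forall>u\<in>B. \<forall>v\<in>B. stack_label i l j (to_upper u) = stack_label i l j (to_upper v))"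
    by (intro ball_cong refl arg_cong2[where f = "(=)"] up)
  have low': "(\<forall>B\<in>d2. \<forall>u\<in>B. \<forall>v\<in>B. vertex_label l j u = vertex_label l j v) \<longleftrightarrow>
      (\<forall>B\<in>d2. \<forall>u\<in>B. \<forall>v\<in>B. stack_label i l j (to_lower u) = stack_label i l j (to_lower v))"
    by (intro ball_cong refl arg_cong2[where f = "(=)"] low)
  have "diagram_coeff d1 i l =
      of_bool (\<forall>B\<in>(`) to_upper ` d1. \<forall>u\<in>B. \<forall>v\<in>B. stack_label i l j u = stack_label i l j v)"
    unfolding diagram_coeff_def up' of_bool_def by (simp only: ball_simps)
  moreover have "diagram_coeff d2 l j =
      of_bool (\<forall>B\<in>(`) to_lower ` d2. \<forall>u\<in>B. \<forall>v\<in>B. stack_label i l j u = stack_label i l j v)"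
    unfolding diagram_coeff_def low' of_bool_def by (simp only: ball_simps)
  ultimately have "diagram_coeff d1 i l * diagram_coeff d2 l j =
      of_bool (\<forall>B\<in>stack d1 d2. \<forall>u\<in>B. \<forall>v\<in>B. stack_label i l j u = stack_label i l j v)"
    unfolding stack_def ball_Un by (simp only: of_bool_conj)
  also have "(\<forall>B\<in>stack d1 d2. \<forall>u\<in>B. \<forall>v\<in>B. stack_label i l j u = stack_label i l j v) \<longleftrightarrow>
      (\<forall>(u, v)\<in>stack_rel d1 d2. stack_label i l j u = stack_label i l j v)"
    unfolding stack_rel_def by blast
  also have "\<dots> \<longleftrightarrow> (\<forall>(u, v)\<in>linked. stack_label i l j u = stack_label i l j v)"
  proof
    assume R: "\<forall>(u, v)\<in>stack_rel d1 d2. stack_label i l j u = stack_label i l j v"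
    have "stack_label i l j u = stack_label i l j v" if "(u, v) \<in> linked" for u v
      using that by (induction rule: rtrancl_induct) (use R in auto)
    then show "\<forall>(u, v)\<in>linked. stack_label i l j u = stack_label i l j v" by blast
  qed blast
  finally show ?thesis .
qed

lemma diagram_coeff_comp_iff:
  "diagram_coeff (diagram_comp d1 d2) i j = of_bool (\<forall>u\<in>vertices (Suc k). \<forall>v\<in>vertices (Suc k).
    (u, v) \<in> linked \<longrightarrow> vertex_label i j u = vertex_label i j v)"
proof -
  have "(\<forall>B\<in>diagram_comp d1 d2. \<forall>u\<in>B. \<forall>v\<in>B. vertex_label i j u = vertex_label i j v) \<longleftrightarrow>
    (\<forall>u\<in>vertices (Suc k). \<forall>v\<in>vertices (Suc k).
      (u, v) \<in> linked \<longrightarrow> vertex_label i j u = vertex_label i j v)" (is "?L \<longleftrightarrow> ?R")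
  proof
    assume L: ?L
    show ?R
    proof (intro ballI impI)
      fix u v assume uv: "u \<in> vertices (Suc k)" "v \<in> vertices (Suc k)" "(u, v) \<in> linked"
      have "{w \<in> vertices (Suc k). (u, w) \<in> linked} \<in> diagram_comp d1 d2"
        unfolding diagram_comp_eq using uv by (intro imageI)
      from L[rule_format, OF this, of u v] show "vertex_label i j u = vertex_label i j v" using uv by simp
    qed
  next
    assume R: ?R
    show ?L
    proof (intro ballI)
      fix B u v assume "B \<in> diagram_comp d1 d2" "u \<in> B" "v \<in> B"
      then have "u \<in> vertices (Suc k)" "v \<in> vertices (Suc k)" "(u, v) \<in> linked"
        unfolding diagram_comp_eq by (auto intro: rtrancl_trans stack_rel_sym)
      then show "vertex_label i j u = vertex_label i j v" using R by blast
    qed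
  qed
  then show ?thesis unfolding diagram_coeff_def of_bool_def by (simp only:)
qed

text \<open>A labelling of the outer rows extends to at most one labelling of the stacked graph that is constant
  on components, as each middle vertex is linked to the top row. The extension exists precisely if the
  given labelling is constant on the blocks of the composition. It lies in \<open>last_tuples\<close> because the
  last vertices of the three rows are linked. So the sum has at most one nonzero term.\<close>

lemma sum_diagram_coeff:
  assumes i: "i \<in> last_tuples n k" and j: "j \<in> last_tuples n k"
  shows "(\<Sum>l\<in>last_tuples n k. diagram_coeff d1 i l * diagram_coeff d2 l j) =
    diagram_coeff (diagram_comp d1 d2) i j"
proof -
  let ?V = "vertices (Suc k)" and ?T = "last_tuples n k"
  define ok where "ok l \<longleftrightarrow> (\<forall>(u, v)\<in>linked. stack_label i l j u = stack_label i l j v)" for l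
  have okD: "stack_label i l j u = stack_label i l j v" if "ok l" "(u, v) \<in> linked" for l u v
    using that unfolding ok_def by blast
  have sum: "(\<Sum>l\<in>?T. diagram_coeff d1 i l * diagram_coeff d2 l j) = (\<Sum>l\<in>?T. of_bool (ok l))"
    unfolding diagram_coeff_mult ok_def ..
  show ?thesis
  proof (cases "\<forall>u\<in>?V. \<forall>v\<in>?V. (u, v) \<in> linked \<longrightarrow> vertex_label i j u = vertex_label i j v")
    case True
    \<comment> \<open>A middle vertex takes the label of any top vertex linked to it.\<close>
    define l where "l r = (if r < Suc k then i (SOME s. s < Suc k \<and> (Mid r, Top s) \<in> linked)
      else undefined)" for r
    have l_conn: "\<exists>s<Suc k. (Mid r, Top s) \<in> linked \<and> l r = i s" if r: "r < Suc k" for r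
      using someI_ex[OF Mid_linked(1)[OF r]] r by (auto simp: l_def)
    have lab: "stack_label i l j v = i s"
      if v: "(v, Top s) \<in> linked" "v \<in> \<Union>(stack d1 d2)" "s < Suc k" for v s
    proof -
      have *: "vertex_label i j u = i s" if "u \<in> ?V" "(u, Top s) \<in> linked" for u
        using True[rule_format, of u "Top s"] that v(3) by (simp add: vertices_simps)
      show ?thesis
      proof (cases "v \<in> ?V")
        case True
        then show ?thesis using * v stack_label_vertex_label by simp
      next
        case False
        then obtain r where r: "r < Suc k" "v = Mid r" using v(2) unfolding stack_vertices by blast
        then obtain s' where s': "s' < Suc k" "(Mid r, Top s') \<in> linked" "l r = i s'"
          using l_conn by blast
        then have "(Top s', Top s) \<in> linked"
          using v(1) r by (meson rtrancl_trans stack_rel_sym)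
        then show ?thesis using *[of "Top s'"] s' r by (simp add: vertices_simps)
      qed
    qed
    have okl: "ok l"
      unfolding ok_def
    proof safe
      fix u v assume uv: "(u, v) \<in> linked"
      show "stack_label i l j u = stack_label i l j v"
      proof (cases "u \<in> \<Union>(stack d1 d2)")
        case True
        then obtain s where s: "s < Suc k" "(u, Top s) \<in> linked" using linked_Top_Bot by blast
        then have "(v, Top s) \<in> linked" using uv by (meson rtrancl_trans stack_rel_sym)
        then show ?thesis using lab s True linked_closed[OF uv True] by simp
      next
        case False
        have "u = v" using uv
        proof (cases rule: converse_rtranclE)
          case (step w)
          then show ?thesis using False by (auto simp: stack_rel_def)
        qed
        then show ?thesis by simp
      qed
    qed
    have lT: "l \<in> ?T"
    proof (rule last_tuplesI)
      show "l r < n" if "r < Suc k" for r using l_conn[OF that] last_tuplesD(3)[OF i] by auto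
      show "l k = n - 1" using okD[OF okl linked_last(1)] last_tuplesD(2)[OF i] by simp
      show "l r = undefined" if "\<not> r < Suc k" for r using that by (simp add: l_def)
    qed
    have uniq: "l' = l" if l': "l' \<in> ?T" "ok l'" for l'
    proof (rule last_tuples_eqI[OF l'(1) lT])
      fix r assume "r < Suc k"
      then obtain s where "(Mid r, Top s) \<in> linked" using Mid_linked by blast
      from okD[OF l'(2) this] okD[OF okl this] show "l' r = l r" by simp
    qed
    have "(\<Sum>l'\<in>?T. of_bool (ok l')) = (\<Sum>l'\<in>?T. if l' = l then 1 else (0 :: complex))"
    proof (rule sum.cong[OF refl])
      fix l' assume "l' \<in> ?T"
      then show "of_bool (ok l') = (if l' = l then 1 else (0 :: complex))"
        using uniq[of l'] okl by (cases "l' = l") auto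
    qed
    also have "\<dots> = 1" using lT finite_last_tuples by simp
    finally have "(\<Sum>l\<in>?T. of_bool (ok l)) = (1 :: complex)" .
    moreover have "diagram_coeff (diagram_comp d1 d2) i j = 1"
      unfolding diagram_coeff_comp_iff of_bool_def by (rule if_P[OF True])
    ultimately show ?thesis unfolding sum by (simp only:)
  next
    case False
    have "\<not> ok l" for l
    proof
      assume ok: "ok l"
      have "vertex_label i j u = vertex_label i j v"
        if "u \<in> ?V" "v \<in> ?V" "(u, v) \<in> linked" for u v
        using okD[OF ok that(3)] stack_label_vertex_label that by metis
      then show False using False by blast
    qed
    moreover have "diagram_coeff (diagram_comp d1 d2) i j = 0"
      unfolding diagram_coeff_comp_iff of_bool_def by (rule if_not_P[OF False])
    ultimately show ?thesis unfolding sum by simp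
  qed
qed

end

lemma diagram_matrix_indicator:
  assumes "d \<in> carrier (I_half_monoid k)"
  shows "diagram_matrix k (\<lambda>e. of_bool (e = d)) i j = diagram_coeff d i j"
proof -
  have "diagram_matrix k (\<lambda>e. of_bool (e = d)) i j =
      (\<Sum>e\<in>carrier (I_half_monoid k). if e = d then diagram_coeff e i j else 0)"
    unfolding diagram_matrix_def by (intro sum.cong) auto
  then show ?thesis using assms finite_I_half by simp
qed

text \<open>The product in the monoid algebra groups the pairs of diagrams by their composition; summing over all
  compositions undoes the grouping.\<close>

lemma diagram_matrix_mult:
  assumes a: "a \<in> carrier (monoid_algebra (I_half_monoid k))"
    and b: "b \<in> carrier (monoid_algebra (I_half_monoid k))"
    and ij: "i \<in> last_tuples n k" "j \<in> last_tuples n k"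
  shows "diagram_matrix k (a \<otimes>\<^bsub>monoid_algebra (I_half_monoid k)\<^esub> b) i j =
    matrix_mult (last_tuples n k) (diagram_matrix k a) (diagram_matrix k b) i j"
proof -
  let ?I = "carrier (I_half_monoid k)" and ?T = "last_tuples n k"
  let ?c = "\<lambda>(x, y). diagram_comp x y"
  let ?Q = "{x. a x \<noteq> 0} \<times> {y. b y \<noteq> 0}"
  have supp: "{x. a x \<noteq> 0} \<subseteq> ?I" "{y. b y \<noteq> 0} \<subseteq> ?I"
    using a b by (auto simp: monoid_algebra_def)
  then have fin: "finite ?Q" using finite_I_half by (meson finite_SigmaI finite_subset)
  have comp: "?c ` ?Q \<subseteq> ?I" using supp diagram_comp_I_half by fastforce
  have mult: "(a \<otimes>\<^bsub>monoid_algebra (I_half_monoid k)\<^esub> b) z =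
      (\<Sum>p\<in>{p\<in>?Q. ?c p = z}. case p of (x, y) \<Rightarrow> a x * b y)" for z
    by (auto simp: monoid_algebra_def I_half_monoid_def I_monoid_def diagram_monoid_def intro!: sum.cong)
  have "diagram_matrix k (a \<otimes>\<^bsub>monoid_algebra (I_half_monoid k)\<^esub> b) i j =
      (\<Sum>z\<in>?I. \<Sum>p\<in>{p\<in>?Q. ?c p = z}. (case p of (x, y) \<Rightarrow> a x * b y) * diagram_coeff (?c p) i j)"
    unfolding diagram_matrix_def mult sum_distrib_right by (intro sum.cong refl) auto
  also have "\<dots> = (\<Sum>p\<in>?Q. (case p of (x, y) \<Rightarrow> a x * b y) * diagram_coeff (?c p) i j)"
    by (rule sum.group[OF fin finite_I_half comp])
  also have "\<dots> = (\<Sum>p\<in>?I \<times> ?I. (case p of (x, y) \<Rightarrow> a x * b y) * diagram_coeff (?c p) i j)"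
    using supp finite_I_half by (intro sum.mono_neutral_left) auto
  also have "\<dots> = (\<Sum>x\<in>?I. \<Sum>y\<in>?I. a x * b y * diagram_coeff (diagram_comp x y) i j)"
    by (simp add: sum.cartesian_product case_prod_unfold)
  also have "\<dots> = (\<Sum>x\<in>?I. \<Sum>y\<in>?I. a x * b y *
      (\<Sum>l\<in>?T. diagram_coeff x i l * diagram_coeff y l j))"
    using sum_diagram_coeff ij by (intro sum.cong refl) simp
  also have "\<dots> = (\<Sum>l\<in>?T. \<Sum>x\<in>?I. \<Sum>y\<in>?I. (a x * diagram_coeff x i l) * (b y * diagram_coeff y l j))"
  proof -
    have "(\<Sum>x\<in>?I. \<Sum>y\<in>?I. a x * b y * (\<Sum>l\<in>?T. diagram_coeff x i l * diagram_coeff y l j)) =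
        (\<Sum>x\<in>?I. \<Sum>y\<in>?I. \<Sum>l\<in>?T. (a x * diagram_coeff x i l) * (b y * diagram_coeff y l j))"
      by (simp add: sum_distrib_left ac_simps)
    also have "\<dots> = (\<Sum>x\<in>?I. \<Sum>l\<in>?T. \<Sum>y\<in>?I. (a x * diagram_coeff x i l) * (b y * diagram_coeff y l j))"
      by (intro sum.cong refl sum.swap)
    also have "\<dots> = (\<Sum>l\<in>?T. \<Sum>x\<in>?I. \<Sum>y\<in>?I. (a x * diagram_coeff x i l) * (b y * diagram_coeff y l j))"
      by (rule sum.swap)
    finally show ?thesis .
  qed
  also have "\<dots> = matrix_mult ?T (diagram_matrix k a) (diagram_matrix k b) i j"
    unfolding matrix_mult_def diagram_matrix_def sum_product ..
  finally show ?thesis .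
qed

lemma one_I_half: "\<one>\<^bsub>I_half_monoid k\<^esub> \<in> carrier (I_half_monoid k)"
proof -
  have "partition_on (vertices (Suc k)) ((\<lambda>r. {Top r, Bot r}) ` {..<Suc k})"
    by (rule partition_onI) (auto simp: vertices_def disjnt_def)
  moreover have "\<one>\<^bsub>I_half_monoid k\<^esub> = (\<lambda>r. {Top r, Bot r}) ` {..<Suc k}"
    by (simp add: I_half_monoid_def I_monoid_def diagram_monoid_def)
  moreover have "propagating {Top r, Bot r}" for r by (simp add: propagating_def)
  ultimately show ?thesis unfolding I_half_iff by simp
qed

lemma diagram_coeff_one:
  assumes "i \<in> last_tuples n k" "j \<in> last_tuples n k"
  shows "diagram_coeff \<one>\<^bsub>I_half_monoid k\<^esub> i j = of_bool (j = i)"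
proof -
  have "\<one>\<^bsub>I_half_monoid k\<^esub> = (\<lambda>r. {Top r, Bot r}) ` {..<Suc k}"
    by (simp add: I_half_monoid_def I_monoid_def diagram_monoid_def)
  then have "(\<forall>B\<in>\<one>\<^bsub>I_half_monoid k\<^esub>. \<forall>u\<in>B. \<forall>v\<in>B. vertex_label i j u = vertex_label i j v)
      \<longleftrightarrow> (\<forall>r<Suc k. i r = j r)"
    by (simp only: ball_simps vertex_label.simps) (metis lessThan_iff)
  then have "diagram_coeff \<one>\<^bsub>I_half_monoid k\<^esub> i j = of_bool (\<forall>r<Suc k. i r = j r)"
    unfolding diagram_coeff_def of_bool_def by (simp only:)
  also have "(\<forall>r<Suc k. i r = j r) \<longleftrightarrow> j = i" using last_tuples_eqI[OF assms] by auto
  finally show ?thesis .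
qed

section \<open>Images, kernel and isomorphism\<close>

lemma carrier_monoid_algebra:
  assumes "finite (carrier M)"
  shows "carrier (monoid_algebra M) = {a. \<forall>x. x \<notin> carrier M \<longrightarrow> a x = 0}"
proof -
  have "finite {x. a x \<noteq> 0}" if "\<forall>x. x \<notin> carrier M \<longrightarrow> a x = 0" for a :: "'a \<Rightarrow> complex"
    by (rule finite_subset[OF _ assms]) (use that in auto)
  then show ?thesis by (auto simp: monoid_algebra_def)
qed

lemma tphi_half_image:
  assumes n: "n > 0"
  shows "tphi_half n k ` carrier (monoid_algebra (I_half_monoid k)) =
    carrier (End_over (monoid_algebra (rook_submonoid n)) (tpsi_half n k) (half_power n k))"
proof -
  let ?T = "last_tuples n k"
  have tpsi: "tpsi_half n k = (\<lambda>b. matrix_op ?T (rook_matrix n k b))" using tpsi_half_eq[OF n] by auto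
  note E = half_power_eq_supported[OF n] tpsi
  show ?thesis
  proof (intro equalityI subsetI)
    fix f assume "f \<in> tphi_half n k ` carrier (monoid_algebra (I_half_monoid k))"
    then obtain a where f: "f = matrix_op ?T (diagram_matrix k a)" using tphi_half_eq[OF n] by auto
    show "f \<in> carrier (End_over (monoid_algebra (rook_submonoid n)) (tpsi_half n k) (half_power n k))"
      unfolding f E End_over_matrix_op_iff[OF finite_last_tuples]
      by (intro ballI types_commute partition_type_diagram_matrix bijection_type_rook_matrix[OF n])
  next
    fix f assume f: "f \<in> carrier (End_over (monoid_algebra (rook_submonoid n)) (tpsi_half n k) (half_power n k))"
    then obtain F where F: "f = matrix_op ?T F" unfolding E using End_over_matrix_op[OF finite_last_tuples] by blast
    have "partition_type (Suc k) ?T F"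
    proof (rule centralizer_bijection_type)
      fix G i j assume G: "bijection_type (Suc k) ?T G" and ij: "i \<in> ?T" "j \<in> ?T"
      obtain b where b: "\<And>A. A \<notin> carrier (rook_submonoid n) \<Longrightarrow> b A = 0"
        "\<And>i j. i \<in> ?T \<Longrightarrow> j \<in> ?T \<Longrightarrow> G i j = rook_matrix n k b i j"
        using bijection_type_realized[OF n G] by metis
      have "b \<in> carrier (monoid_algebra (rook_submonoid n))"
        using b(1) by (simp add: carrier_monoid_algebra[OF finite_rook[OF n]])
      then have "matrix_mult ?T F (rook_matrix n k b) i j = matrix_mult ?T (rook_matrix n k b) F i j"
        using f ij unfolding F E End_over_matrix_op_iff[OF finite_last_tuples] by blast
      then show "matrix_mult ?T F G i j = matrix_mult ?T G F i j"
        using b(2) ij by (simp add: matrix_mult_def)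
    qed
    then obtain a where a: "\<And>d. d \<notin> carrier (I_half_monoid k) \<Longrightarrow> a d = 0"
      "\<And>i j. i \<in> ?T \<Longrightarrow> j \<in> ?T \<Longrightarrow> F i j = diagram_matrix k a i j"
      using partition_type_realized by metis
    have "f = tphi_half n k a" unfolding F tphi_half_eq[OF n] using a(2) by (rule matrix_op_cong)
    then show "f \<in> tphi_half n k ` carrier (monoid_algebra (I_half_monoid k))"
      using a(1) by (simp add: carrier_monoid_algebra[OF finite_I_half])
  qed
qed

lemma tpsi_half_image:
  assumes n: "n > 0"
  shows "tpsi_half n k ` carrier (monoid_algebra (rook_submonoid n)) =
    carrier (End_over (monoid_algebra (I_half_monoid k)) (tphi_half n k) (half_power n k))"
proof -
  let ?T = "last_tuples n k"
  have tphi: "tphi_half n k = (\<lambda>a. matrix_op ?T (diagram_matrix k a))" using tphi_half_eq[OF n] by auto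
  note E = half_power_eq_supported[OF n] tphi
  show ?thesis
  proof (intro equalityI subsetI)
    fix f assume "f \<in> tpsi_half n k ` carrier (monoid_algebra (rook_submonoid n))"
    then obtain b where f: "f = matrix_op ?T (rook_matrix n k b)" using tpsi_half_eq[OF n] by auto
    show "f \<in> carrier (End_over (monoid_algebra (I_half_monoid k)) (tphi_half n k) (half_power n k))"
      unfolding f E End_over_matrix_op_iff[OF finite_last_tuples]
      by (intro ballI types_commute[symmetric] partition_type_diagram_matrix bijection_type_rook_matrix[OF n])
  next
    fix f assume f: "f \<in> carrier (End_over (monoid_algebra (I_half_monoid k)) (tphi_half n k) (half_power n k))"
    then obtain G where G: "f = matrix_op ?T G" unfolding E using End_over_matrix_op[OF finite_last_tuples] by blast
    have "bijection_type (Suc k) ?T G"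
    proof (rule centralizer_partition_type)
      fix F i j assume F: "partition_type (Suc k) ?T F" and ij: "i \<in> ?T" "j \<in> ?T"
      obtain a where a: "\<And>d. d \<notin> carrier (I_half_monoid k) \<Longrightarrow> a d = 0"
        "\<And>i j. i \<in> ?T \<Longrightarrow> j \<in> ?T \<Longrightarrow> F i j = diagram_matrix k a i j"
        using partition_type_realized[OF F] by metis
      have "a \<in> carrier (monoid_algebra (I_half_monoid k))"
        using a(1) by (simp add: carrier_monoid_algebra[OF finite_I_half])
      then have "matrix_mult ?T G (diagram_matrix k a) i j = matrix_mult ?T (diagram_matrix k a) G i j"
        using f ij unfolding G E End_over_matrix_op_iff[OF finite_last_tuples] by blast
      then show "matrix_mult ?T G F i j = matrix_mult ?T F G i j"
        using a(2) ij by (simp add: matrix_mult_def)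
    qed
    then obtain b where b: "\<And>A. A \<notin> carrier (rook_submonoid n) \<Longrightarrow> b A = 0"
      "\<And>i j. i \<in> ?T \<Longrightarrow> j \<in> ?T \<Longrightarrow> G i j = rook_matrix n k b i j"
      using bijection_type_realized[OF n] by metis
    have "f = tpsi_half n k b" unfolding G tpsi_half_eq[OF n] using b(2) by (rule matrix_op_cong)
    then show "f \<in> tpsi_half n k ` carrier (monoid_algebra (rook_submonoid n))"
      using b(1) by (simp add: carrier_monoid_algebra[OF finite_rook[OF n]])
  qed
qed

lemma tphi_half_kernel:
  assumes n: "n > 0"
  shows "a_kernel (monoid_algebra (I_half_monoid k)) (End_C (half_power n k)) (tphi_half n k) =
    cspan (x_basis (Suc k) ` {d \<in> carrier (I_half_monoid k). card d > n})"
proof -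
  have "a_kernel (monoid_algebra (I_half_monoid k)) (End_C (half_power n k)) (tphi_half n k) =
    {a. (\<forall>d. d \<notin> carrier (I_half_monoid k) \<longrightarrow> a d = 0) \<and>
      (\<forall>e\<in>carrier (I_half_monoid k). card e \<le> n \<longrightarrow> refinement_sum k a e = 0)}"
    unfolding a_kernel_def' carrier_monoid_algebra[OF finite_I_half] tphi_half_eq[OF n]
    by (simp add: End_C_def half_power_eq_supported[OF n] matrix_op_zero_iff[OF finite_last_tuples]
        diagram_matrix_eq_0_iff[OF n])
  then show ?thesis using diagram_matrix_kernel[OF n] by simp
qed

text \<open>With \<open>n \<ge> k + 1\<close> every diagram in \<open>I_{k+1/2}\<close> has at most \<open>n\<close> blocks. So equal operators come from
  algebra elements with equal refinement sums, and these determine the element.\<close>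

lemma CI_algebra_isomorphic:
  assumes n: "n > 0" and nk: "n \<ge> k + 1"
  shows "algebra_isomorphic (monoid_algebra (I_half_monoid k))
    (End_over (monoid_algebra (rook_submonoid n)) (tpsi_half n k) (half_power n k))"
proof -
  let ?A = "monoid_algebra (I_half_monoid k)" and ?T = "last_tuples n k"
  let ?E = "End_over (monoid_algebra (rook_submonoid n)) (tpsi_half n k) (half_power n k)"
  note phi = tphi_half_eq[OF n]
  have E: "monoid.mult ?E = (\<lambda>f g. compose (supported ?T) g f)" "one ?E = (\<lambda>w\<in>supported ?T. w)"
    "add ?E = (\<lambda>f g. \<lambda>w\<in>supported ?T. f w + g w)" "smult ?E = (\<lambda>c f. \<lambda>w\<in>supported ?T. cscale c (f w))"
    by (simp_all add: End_over_def End_C_def half_power_eq_supported[OF n])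
  have img: "tphi_half n k ` carrier ?A = carrier ?E" by (rule tphi_half_image[OF n])
  have "tphi_half n k \<in> Ring.ring_hom ?A ?E"
  proof (rule ring_hom_memI)
    show "tphi_half n k a \<in> carrier ?E" if "a \<in> carrier ?A" for a using img that by blast
    show "tphi_half n k (a \<otimes>\<^bsub>?A\<^esub> b) = tphi_half n k a \<otimes>\<^bsub>?E\<^esub> tphi_half n k b"
      if "a \<in> carrier ?A" "b \<in> carrier ?A" for a b
      unfolding phi E matrix_op_compose[OF finite_last_tuples]
      using diagram_matrix_mult[OF that] by (rule matrix_op_cong)
    show "tphi_half n k (a \<oplus>\<^bsub>?A\<^esub> b) = tphi_half n k a \<oplus>\<^bsub>?E\<^esub> tphi_half n k b" for a b
      unfolding phi E matrix_op_add[symmetric]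
      by (rule matrix_op_cong) (simp add: monoid_algebra_def diagram_matrix_def algebra_simps sum.distrib)
    have "one ?A = (\<lambda>e. of_bool (e = \<one>\<^bsub>I_half_monoid k\<^esub>))" by (simp add: monoid_algebra_def)
    then show "tphi_half n k \<one>\<^bsub>?A\<^esub> = \<one>\<^bsub>?E\<^esub>"
      unfolding phi E matrix_op_one[OF finite_last_tuples, symmetric]
      by (intro matrix_op_cong) (simp add: diagram_matrix_indicator[OF one_I_half] diagram_coeff_one)
  qed
  moreover have "inj_on (tphi_half n k) (carrier ?A)"
  proof (rule inj_onI)
    fix a b assume a: "a \<in> carrier ?A" and b: "b \<in> carrier ?A" and eq: "tphi_half n k a = tphi_half n k b"
    have "diagram_matrix k (a - b) i j = 0" if "i \<in> ?T" "j \<in> ?T" for i j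
      using matrix_op_eqD[OF finite_last_tuples eq[unfolded phi] that]
      by (simp add: diagram_matrix_def algebra_simps sum_subtractf)
    moreover have "card e \<le> n" if "e \<in> carrier (I_half_monoid k)" for e
      using card_I_half[OF that] nk by simp
    ultimately have "refinement_sum k (a - b) e = 0" if "e \<in> carrier (I_half_monoid k)" for e
      using diagram_matrix_eq_0_iff[OF n, of k "a - b"] that by blast
    moreover have "a - b = (\<Sum>e\<in>carrier (I_half_monoid k).
        cscale (refinement_sum k (a - b) e) (x_basis (Suc k) e))"
      by (rule x_basis_expansion_I_half)
        (use a b in \<open>auto simp: carrier_monoid_algebra[OF finite_I_half]\<close>)
    ultimately have "a - b = (\<Sum>e\<in>carrier (I_half_monoid k). 0)"
      by (simp add: cscale_def zero_fun_def cong: sum.cong)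
    then show "a = b" by simp
  qed
  moreover have "tphi_half n k (c \<odot>\<^bsub>?A\<^esub> a) = c \<odot>\<^bsub>?E\<^esub> tphi_half n k a" for c a
    unfolding phi E matrix_op_scale[symmetric]
    by (rule matrix_op_cong)
      (simp add: monoid_algebra_def diagram_matrix_def cscale_def sum_distrib_left mult.assoc)
  ultimately show ?thesis
    unfolding algebra_isomorphic_def ring_iso_def bij_betw_def using img by blast
qed

theorem corollary3p9:
  fixes n k :: nat
  assumes "n > 0"
  defines "W \<equiv> half_power n k"
    and "CI \<equiv> monoid_algebra (I_half_monoid k)"
    and "CR \<equiv> monoid_algebra (rook_submonoid n)"
  shows
    "(tphi_half n k ` carrier CI = carrier (End_over CR (tpsi_half n k) W) \<and>
      a_kernel CI (End_C W) (tphi_half n k) =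
        cspan (x_basis (Suc k) ` {d \<in> carrier (I_half_monoid k). card d > n}) \<and>
      (n \<ge> k + 1 \<longrightarrow> algebra_isomorphic CI (End_over CR (tpsi_half n k) W))) \<and>
     tpsi_half n k ` carrier CR = carrier (End_over CI (tphi_half n k) W)"
  unfolding W_def CI_def CR_def
  using tphi_half_image[OF assms(1)] tphi_half_kernel[OF assms(1)] CI_algebra_isomorphic[OF assms(1)]
    tpsi_half_image[OF assms(1)] by blast

end
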